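(* Let $\Omega$ be a simply connected domain in $\mathbb{C}$. Then there exists a function $f \in \mathcal{H}_{l.u.}(\Omega)$ such that $\{f \circ \phi : \phi \in \mathrm{Aut}(\Omega)\}$ is dense in $\mathcal{H}_{l.u.}(\Omega)$.
   Context: $\mathcal{H}_{l.u.}(\Omega)$ is the set of all locally univalent holomorphic functions on $\Omega$, i.e. holomorphic $f:\Omega\to\mathbb{C}$ with $f'(z)\neq 0$ for all $z\in\Omega$, equipped with the topology of locally uniform convergence on $\Omega$. $\mathrm{Aut}(\Omega)$ is the group of all conformal automorphisms (biholomorphic self-maps) of $\Omega$. *)

theory Defs
  imports "HOL-Complex_Analysis.Complex_Analysis" "HOL-Library.FuncSet"
begin

text \<open>
  A function on \<open>\<Omega>\<close> is represented by the total function that is \<open>undefined\<close> outside \<open>\<Omega>\<close>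
  (the set \<open>extensional \<Omega>\<close>), so that two functions agreeing on \<open>\<Omega>\<close> are equal. Composition
  of such functions is \<open>compose \<Omega>\<close>.
\<close>

definition locally_univalent :: "complex set \<Rightarrow> (complex \<Rightarrow> complex) set" where
  "locally_univalent \<Omega> =
     {f \<in> extensional \<Omega>. f holomorphic_on \<Omega> \<and> (\<forall>z\<in>\<Omega>. deriv f z \<noteq> 0)}"

definition conformal_automorphisms :: "complex set \<Rightarrow> (complex \<Rightarrow> complex) set" where
  "conformal_automorphisms \<Omega> =
     {\<phi> \<in> extensional \<Omega>. bij_betw \<phi> \<Omega> \<Omega> \<and> \<phi> holomorphic_on \<Omega> \<and> inv_into \<Omega> \<phi> holomorphic_on \<Omega>}"

definition unif_nbhd ::
    "complex set \<Rightarrow> complex set \<Rightarrow> real \<Rightarrow> (complex \<Rightarrow> complex) \<Rightarrow> (complex \<Rightarrow> complex) set" where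
  "unif_nbhd \<Omega> K \<epsilon> f = {g \<in> locally_univalent \<Omega>. \<forall>z\<in>K. dist (g z) (f z) < \<epsilon>}"

text \<open>
  Uniform convergence on compact subsets; on an open set this is the same as locally uniform
  convergence, see \<open>limitin_lu_topology_iff_locally\<close>.
\<close>
definition lu_topology :: "complex set \<Rightarrow> (complex \<Rightarrow> complex) topology" where
  "lu_topology \<Omega> = topology (\<lambda>U. U \<subseteq> locally_univalent \<Omega> \<and>
     (\<forall>f\<in>U. \<exists>K \<epsilon>. compact K \<and> K \<subseteq> \<Omega> \<and> \<epsilon> > 0 \<and> unif_nbhd \<Omega> K \<epsilon> f \<subseteq> U))"

lemma openin_lu_topology:
  "openin (lu_topology \<Omega>) U \<longleftrightarrow> U \<subseteq> locally_univalent \<Omega> \<and>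
     (\<forall>f\<in>U. \<exists>K \<epsilon>. compact K \<and> K \<subseteq> \<Omega> \<and> \<epsilon> > 0 \<and> unif_nbhd \<Omega> K \<epsilon> f \<subseteq> U)"
proof -
  let ?P = "\<lambda>U. U \<subseteq> locally_univalent \<Omega> \<and>
     (\<forall>f\<in>U. \<exists>K \<epsilon>. compact K \<and> K \<subseteq> \<Omega> \<and> \<epsilon> > 0 \<and> unif_nbhd \<Omega> K \<epsilon> f \<subseteq> U)"
  have "?P (S \<inter> T)" if S: "?P S" and T: "?P T" for S T
  proof (intro conjI ballI)
    fix f assume f: "f \<in> S \<inter> T"
    obtain K d where K: "compact K" "K \<subseteq> \<Omega>" "d > 0" "unif_nbhd \<Omega> K d f \<subseteq> S" using S f by blast
    obtain L e where L: "compact L" "L \<subseteq> \<Omega>" "e > 0" "unif_nbhd \<Omega> L e f \<subseteq> T" using T f by blast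
    have "unif_nbhd \<Omega> (K \<union> L) (min d e) f \<subseteq> unif_nbhd \<Omega> K d f \<inter> unif_nbhd \<Omega> L e f"
      by (auto simp: unif_nbhd_def)
    then have "compact (K \<union> L) \<and> K \<union> L \<subseteq> \<Omega> \<and> min d e > 0 \<and> unif_nbhd \<Omega> (K \<union> L) (min d e) f \<subseteq> S \<inter> T"
      using K L by auto
    then show "\<exists>K \<epsilon>. compact K \<and> K \<subseteq> \<Omega> \<and> \<epsilon> > 0 \<and> unif_nbhd \<Omega> K \<epsilon> f \<subseteq> S \<inter> T" by blast
  qed (use S in blast)
  moreover have "?P (\<Union>\<K>)" if P: "\<forall>S\<in>\<K>. ?P S" for \<K>
  proof (intro conjI ballI)
    show "\<Union>\<K> \<subseteq> locally_univalent \<Omega>" using P by (simp add: Sup_le_iff)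
  next
    fix f assume "f \<in> \<Union>\<K>"
    then obtain S where S: "S \<in> \<K>" "f \<in> S" by (rule UnionE)
    have "?P S" using P S(1) by (rule bspec)
    then have "\<exists>K \<epsilon>. compact K \<and> K \<subseteq> \<Omega> \<and> \<epsilon> > 0 \<and> unif_nbhd \<Omega> K \<epsilon> f \<subseteq> S" using S(2) by simp
    moreover have "S \<subseteq> \<Union>\<K>" using S(1) by (rule Union_upper)
    ultimately show "\<exists>K \<epsilon>. compact K \<and> K \<subseteq> \<Omega> \<and> \<epsilon> > 0 \<and> unif_nbhd \<Omega> K \<epsilon> f \<subseteq> \<Union>\<K>"
      by (meson subset_trans)
  qed
  ultimately have "istopology ?P" unfolding istopology_def by presburger
  then show ?thesis by (simp add: lu_topology_def)
qed

lemma topspace_lu_topology [simp]: "topspace (lu_topology \<Omega>) = locally_univalent \<Omega>"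
proof
  have "openin (lu_topology \<Omega>) (locally_univalent \<Omega>)"
    unfolding openin_lu_topology
    by (intro conjI ballI exI[of _ "{}"] exI[of _ 1]) (auto simp: unif_nbhd_def)
  then show "locally_univalent \<Omega> \<subseteq> topspace (lu_topology \<Omega>)" by (rule openin_subset)
  show "topspace (lu_topology \<Omega>) \<subseteq> locally_univalent \<Omega>"
    using openin_lu_topology[of \<Omega> "topspace (lu_topology \<Omega>)"] by simp
qed

lemma openin_unif_nbhd:
  assumes f: "f \<in> locally_univalent \<Omega>" and K: "compact K" "K \<subseteq> \<Omega>"
  shows "openin (lu_topology \<Omega>) (unif_nbhd \<Omega> K \<epsilon> f)"
  unfolding openin_lu_topology
proof (intro conjI ballI)
  fix g assume g: "g \<in> unif_nbhd \<Omega> K \<epsilon> f"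
  have "\<exists>d>0. \<forall>z\<in>K. dist (g z) (f z) \<le> \<epsilon> - d"
  proof (cases "K = {}")
    case False
    have "continuous_on K f" "continuous_on K g"
      using f g K by (auto simp: unif_nbhd_def locally_univalent_def
          intro: continuous_on_subset holomorphic_on_imp_continuous_on)
    then have "continuous_on K (\<lambda>z. dist (g z) (f z))" by (intro continuous_intros)
    then obtain w where "w \<in> K" "\<forall>z\<in>K. dist (g z) (f z) \<le> dist (g w) (f w)"
      using continuous_attains_sup[OF K(1) False] by blast
    then show ?thesis
      using g by (intro exI[of _ "\<epsilon> - dist (g w) (f w)"]) (auto simp: unif_nbhd_def)
  qed (auto intro: exI[of _ 1])
  then obtain d where d: "d > 0" "\<forall>z\<in>K. dist (g z) (f z) \<le> \<epsilon> - d" by blast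
  have "unif_nbhd \<Omega> K d g \<subseteq> unif_nbhd \<Omega> K \<epsilon> f"
  proof
    fix h assume h: "h \<in> unif_nbhd \<Omega> K d g"
    have "dist (h z) (f z) < \<epsilon>" if "z \<in> K" for z
    proof -
      have "dist (h z) (g z) < d" "dist (g z) (f z) \<le> \<epsilon> - d"
        using h d that by (auto simp: unif_nbhd_def)
      then show ?thesis using dist_triangle[of "h z" "f z" "g z"] by linarith
    qed
    then show "h \<in> unif_nbhd \<Omega> K \<epsilon> f" using h by (auto simp: unif_nbhd_def)
  qed
  then show "\<exists>L d. compact L \<and> L \<subseteq> \<Omega> \<and> d > 0 \<and> unif_nbhd \<Omega> L d g \<subseteq> unif_nbhd \<Omega> K \<epsilon> f"
    using K d by blast
qed (auto simp: unif_nbhd_def)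

lemma limitin_lu_topology:
  "limitin (lu_topology \<Omega>) f g F \<longleftrightarrow>
     g \<in> locally_univalent \<Omega> \<and> eventually (\<lambda>n. f n \<in> locally_univalent \<Omega>) F \<and>
     (\<forall>K. compact K \<and> K \<subseteq> \<Omega> \<longrightarrow> uniform_limit K f g F)" (is "?L \<longleftrightarrow> ?R")
proof
  assume L: ?L
  then have g: "g \<in> locally_univalent \<Omega>" by (auto simp: limitin_def)
  have "eventually (\<lambda>n. f n \<in> locally_univalent \<Omega>) F"
    using L openin_topspace[of "lu_topology \<Omega>"] by (auto simp: limitin_def)
  moreover have "uniform_limit K f g F" if K: "compact K" "K \<subseteq> \<Omega>" for K
  proof (rule uniform_limitI)
    fix e :: real assume "e > 0"
    then have "g \<in> unif_nbhd \<Omega> K e g" using g by (auto simp: unif_nbhd_def)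
    then have "eventually (\<lambda>n. f n \<in> unif_nbhd \<Omega> K e g) F"
      using L openin_unif_nbhd[OF g K] by (auto simp: limitin_def)
    then show "\<forall>\<^sub>F n in F. \<forall>z\<in>K. dist (f n z) (g z) < e"
      by eventually_elim (auto simp: unif_nbhd_def)
  qed
  ultimately show ?R using g by blast
next
  assume R: ?R
  have "eventually (\<lambda>n. f n \<in> U) F" if U: "openin (lu_topology \<Omega>) U" "g \<in> U" for U
  proof -
    obtain K e where K: "compact K" "K \<subseteq> \<Omega>" "e > 0" "unif_nbhd \<Omega> K e g \<subseteq> U"
      using iffD1[OF openin_lu_topology U(1), THEN conjunct2] U(2) by meson
    have "\<forall>\<^sub>F n in F. \<forall>z\<in>K. dist (f n z) (g z) < e"
      using R K by (intro uniform_limitD) simp_all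
    moreover have "eventually (\<lambda>n. f n \<in> locally_univalent \<Omega>) F" using R by blast
    ultimately show ?thesis
    proof eventually_elim
      case (elim n)
      then have "f n \<in> unif_nbhd \<Omega> K e g" by (simp add: unif_nbhd_def)
      then show ?case using K(4) by (rule rev_subsetD)
    qed
  qed
  then show ?L using R by (simp add: limitin_def)
qed

lemma limitin_lu_topology_iff_locally:
  assumes "open \<Omega>"
  shows "limitin (lu_topology \<Omega>) f g F \<longleftrightarrow>
     g \<in> locally_univalent \<Omega> \<and> eventually (\<lambda>n. f n \<in> locally_univalent \<Omega>) F \<and>
     (\<forall>z\<in>\<Omega>. \<exists>U. open U \<and> z \<in> U \<and> U \<subseteq> \<Omega> \<and> uniform_limit U f g F)"
proof -
  have "(\<forall>K. compact K \<and> K \<subseteq> \<Omega> \<longrightarrow> uniform_limit K f g F) \<longleftrightarrow>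
        (\<forall>z\<in>\<Omega>. \<exists>U. open U \<and> z \<in> U \<and> U \<subseteq> \<Omega> \<and> uniform_limit U f g F)" (is "?L \<longleftrightarrow> ?R")
  proof
    assume L: ?L
    show ?R
    proof
      fix z assume "z \<in> \<Omega>"
      then obtain r where r: "r > 0" "cball z r \<subseteq> \<Omega>" using assms open_contains_cball by blast
      then have "uniform_limit (ball z r) f g F"
        using L uniform_limit_on_subset[OF _ ball_subset_cball] by (meson compact_cball)
      then show "\<exists>U. open U \<and> z \<in> U \<and> U \<subseteq> \<Omega> \<and> uniform_limit U f g F"
        using r ball_subset_cball[of z r] by (intro exI[of _ "ball z r"]) auto
    qed
  next
    assume R: ?R
    show ?L
    proof (intro allI impI)
      fix K assume K: "compact K \<and> K \<subseteq> \<Omega>"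
      let ?\<U> = "{U. open U \<and> uniform_limit U f g F}"
      have "K \<subseteq> \<Union>?\<U>" using K R by blast
      then obtain \<D> where D: "\<D> \<subseteq> ?\<U>" "finite \<D>" "K \<subseteq> \<Union>\<D>"
        using compactE[of K ?\<U>] K by blast
      have "uniform_limit (\<Union>\<D>) f g F"
        using D(2,1) by (induction) (auto intro: uniform_limit_on_Un)
      then show "uniform_limit K f g F" using D(3) uniform_limit_on_subset by blast
    qed
  qed
  then show ?thesis by (simp add: limitin_lu_topology)
qed

lemma compose_in_locally_univalent:
  assumes "open \<Omega>" and f: "f \<in> locally_univalent \<Omega>" and \<phi>: "\<phi> \<in> conformal_automorphisms \<Omega>"
  shows "compose \<Omega> f \<phi> \<in> locally_univalent \<Omega>"
proof -
  have hol: "\<phi> holomorphic_on \<Omega>" "f holomorphic_on \<Omega>" and im: "\<phi> ` \<Omega> = \<Omega>" and inj: "inj_on \<phi> \<Omega>"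
    using f \<phi> by (auto simp: locally_univalent_def conformal_automorphisms_def bij_betw_def)
  have "(f \<circ> \<phi>) holomorphic_on \<Omega>" using hol im by (simp add: holomorphic_on_compose)
  then have "compose \<Omega> f \<phi> holomorphic_on \<Omega>"
    by (rule holomorphic_transform) (simp add: compose_def)
  moreover have "deriv (compose \<Omega> f \<phi>) z \<noteq> 0" if z: "z \<in> \<Omega>" for z
  proof -
    have "deriv (compose \<Omega> f \<phi>) z = deriv (f \<circ> \<phi>) z"
    proof (rule deriv_cong_ev)
      show "\<forall>\<^sub>F w in nhds z. compose \<Omega> f \<phi> w = (f \<circ> \<phi>) w"
        using eventually_nhds_in_open[OF \<open>open \<Omega>\<close> z] by eventually_elim (simp add: compose_def)
    qed simp
    also have "\<dots> = deriv f (\<phi> z) * deriv \<phi> z"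
      using hol im z \<open>open \<Omega>\<close> by (intro deriv_chain) (blast intro: holomorphic_on_imp_differentiable_at)+
    also have "\<dots> \<noteq> 0"
      using f im z holomorphic_injective_imp_regular[OF hol(1) \<open>open \<Omega>\<close> inj z]
      by (auto simp: locally_univalent_def)
    finally show ?thesis .
  qed
  ultimately show ?thesis by (simp add: locally_univalent_def)
qed

end

theory Submission
  imports Defs
begin

text \<open>
  By the Riemann mapping theorem a simply connected domain is either the plane or biholomorphic to the
  strip \<open>\<bar>Im z\<bar> < pi / 2\<close>
  (\<open>simply_connected_biholomorphic_translation_invariant\<close>). Both models are convex and invariant under
  real translations, and conjugating a translation gives an automorphism of the original domain. It
  therefore suffices to find, on such a model, one locally univalent function whose real translates
  approximate every locally univalent function uniformly on compact sets
  (\<open>universal_noncritical_translates\<close>).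

  This follows Birkhoff's construction of a universal entire function. Countably many targets suffice
  (\<open>separable_continuous_functions_on_compact\<close>), and they are approximated one after the other on
  translates moving away, each stage changing very little on the compact sets used before. Local
  univalence survives in the limit by Hurwitz's theorem (\<open>Hurwitz_deriv_nonzero\<close>).

  A single stage has to combine two locally univalent functions into one that is close to the first
  on a compact set \<open>K\<close> and to the second on a distant translate \<open>K + T\<close>
  (\<open>noncritical_blend_translates\<close>). Interpolating the functions themselves would create critical
  points, so the logarithms of their derivatives are interpolated instead. Passing back to a primitive
  leaves one additive constant on \<open>K + T\<close> to be adjusted, namely an integral along the segment from \<open>K\<close> to
  \<open>K + T\<close>. The interpolating functions are polynomials that approximate \<open>0\<close> on \<open>K\<close> and \<open>1\<close> on \<open>K + T\<close>
  and stay bounded on that segment, so dominated convergence computes the integral, and a free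
  constant on the middle part of the segment gives it the required value.
\<close>

section \<open>Functions without critical points\<close>

text \<open>
  Membership in \<open>locally_univalent \<Omega>\<close> also fixes the values outside \<open>\<Omega>\<close>. Limits, translates and
  compositions are formed with total functions, so the analytic half of the condition gets a name.
\<close>
definition noncritical_on :: "complex set \<Rightarrow> (complex \<Rightarrow> complex) \<Rightarrow> bool" where
  "noncritical_on S f \<longleftrightarrow> f holomorphic_on S \<and> (\<forall>z\<in>S. deriv f z \<noteq> 0)"

section \<open>Polynomial approximation of a step\<close>

text \<open>
  This cubic has superattracting fixed points at \<open>0\<close> and \<open>1\<close> and a repelling one at \<open>1/2\<close>. Its
  iterates therefore converge uniformly to \<open>0\<close> on a complex disc around \<open>0\<close> and to \<open>1\<close> on a disc
  around \<open>1\<close>. They map \<open>[0, 1]\<close> into itself and converge there to the step at \<open>1/2\<close>, which keeps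
  them bounded on a path joining the discs. Runge's theorem on two disjoint discs would give no such
  bound between them.
\<close>
definition smoothstep :: "complex \<Rightarrow> complex" where
  "smoothstep w = w\<^sup>2 * (3 - 2 * w)"

lemma holomorphic_smoothstep_iterate: "(smoothstep ^^ n) holomorphic_on A"
proof -
  have "(smoothstep ^^ n) holomorphic_on UNIV"
  proof (induction n)
    case (Suc n)
    have "smoothstep holomorphic_on UNIV"
      unfolding smoothstep_def by (intro holomorphic_intros)
    with Suc show ?case
      unfolding funpow.simps by (intro holomorphic_on_compose_gen[where t = UNIV]) auto
  qed (simp add: id_def)
  then show ?thesis by (rule holomorphic_on_subset) simp
qed

text \<open>
  The symmetry \<open>w \<mapsto> 1 - w\<close> exchanges the two superattracting points, so each statement about \<open>0\<close>
  gives one about \<open>1\<close>.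
\<close>
lemma smoothstep_reflect: "smoothstep (1 - w) = 1 - smoothstep w"
  unfolding smoothstep_def by algebra

lemma smoothstep_iterate_reflect: "(smoothstep ^^ n) (1 - w) = 1 - (smoothstep ^^ n) w"
  by (induction n) (simp_all add: smoothstep_reflect)

lemma norm_smoothstep_iterate_near_0:
  assumes "norm w \<le> 1/8"
  shows "norm ((smoothstep ^^ n) w) \<le> (1/2)^n"
proof -
  have "norm ((smoothstep ^^ n) w) \<le> (1/2)^n * (1/8)"
  proof (induction n)
    case 0
    then show ?case using assms by simp
  next
    case (Suc n)
    define v where "v = (smoothstep ^^ n) w"
    have v: "norm v \<le> (1/2)^n * (1/8)" using Suc by (simp add: v_def)
    also have "\<dots> \<le> 1/8" by (simp add: power_le_one)
    finally have v8: "norm v \<le> 1/8" .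
    have "norm (3 - 2 * v) \<le> 3 + 2 * norm v"
      by (metis norm_mult norm_numeral norm_triangle_ineq4)
    then have "norm v * norm (3 - 2 * v) \<le> (1/8) * 4"
      using v8 by (intro mult_mono) auto
    then have "norm v * (norm v * norm (3 - 2 * v)) \<le> norm v * (1/2)"
      by (intro mult_left_mono) auto
    then have "norm (smoothstep v) \<le> norm v * (1/2)"
      by (simp add: smoothstep_def norm_mult norm_power power2_eq_square mult.assoc)
    then show ?case using v by (simp add: v_def)
  qed
  then show ?thesis by (rule order_trans) (simp add: field_simps)
qed

lemma norm_smoothstep_iterate_near_1:
  assumes "norm (w - 1) \<le> 1/8"
  shows "norm ((smoothstep ^^ n) w - 1) \<le> (1/2)^n"
proof -
  have "(smoothstep ^^ n) w - 1 = - (smoothstep ^^ n) (1 - w)"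
    by (simp add: smoothstep_iterate_reflect)
  then show ?thesis
    using norm_smoothstep_iterate_near_0[of "1 - w" n] assms by (simp add: norm_minus_commute)
qed

lemma smoothstep_iterate_unit_interval:
  assumes "0 \<le> x" "x \<le> (1::real)"
  obtains y where "(smoothstep ^^ n) (of_real x) = of_real y" "0 \<le> y" "y \<le> 1"
proof -
  have "\<exists>y. (smoothstep ^^ n) (of_real x) = of_real y \<and> 0 \<le> y \<and> y \<le> 1"
  proof (induction n)
    case 0
    then show ?case using assms by auto
  next
    case (Suc n)
    then obtain y where y: "(smoothstep ^^ n) (of_real x) = of_real y" "0 \<le> y" "y \<le> 1" by blast
    have "(smoothstep ^^ Suc n) (of_real x) = of_real (y\<^sup>2 * (3 - 2 * y))"
      using y by (simp add: smoothstep_def)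
    moreover have "y\<^sup>2 * (3 - 2 * y) \<ge> 0" using y by simp
    moreover have "1 - y\<^sup>2 * (3 - 2 * y) = (1 - y)\<^sup>2 * (1 + 2 * y)"
      by algebra
    then have "1 - y\<^sup>2 * (3 - 2 * y) \<ge> 0" using y by simp
    ultimately show ?case by (intro exI[of _ "y\<^sup>2 * (3 - 2 * y)"]) auto
  qed
  then show ?thesis using that by blast
qed

lemma norm_smoothstep_iterate_unit_interval:
  assumes "0 \<le> x" "x \<le> (1::real)"
  shows "norm ((smoothstep ^^ n) (of_real x)) \<le> 1"
  by (rule smoothstep_iterate_unit_interval[OF assms, of n]) simp

text \<open>
  For \<open>y\<close> in \<open>[0, x]\<close> one step multiplies \<open>y\<close> by \<open>y * (3 - 2 * y)\<close>, which is at most the constant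
  \<open>x * (3 - 2 * x)\<close>. This constant is below \<open>1\<close> precisely because \<open>x < 1/2\<close>.
\<close>
lemma smoothstep_iterate_tendsto_0:
  assumes "0 \<le> x" "x < (1/2::real)"
  shows "(\<lambda>n. (smoothstep ^^ n) (of_real x)) \<longlonglongrightarrow> 0"
proof -
  define k where "k = x * (3 - 2 * x)"
  have "1 - k = (1 - x) * (1 - 2 * x)" unfolding k_def by algebra
  also have "\<dots> > 0" using assms by (intro mult_pos_pos) auto
  finally have k: "k < 1" by simp
  have k0: "0 \<le> k" unfolding k_def using assms by simp
  have *: "\<exists>y. (smoothstep ^^ n) (of_real x) = of_real y \<and> 0 \<le> y \<and> y \<le> x \<and> y \<le> k^n" for n
  proof (induction n)
    case 0
    then show ?case using assms by auto
  next
    case (Suc n)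
    then obtain y where y: "(smoothstep ^^ n) (of_real x) = of_real y" "0 \<le> y" "y \<le> x" "y \<le> k^n"
      by blast
    define z where "z = y * (y * (3 - 2 * y))"
    have "k - y * (3 - 2 * y) = (x - y) * (3 - 2 * (x + y))" unfolding k_def by algebra
    also have "\<dots> \<ge> 0" using y assms by (intro mult_nonneg_nonneg) auto
    finally have le: "y * (3 - 2 * y) \<le> k" by simp
    have "z \<le> y * k" unfolding z_def using le y by (intro mult_left_mono) auto
    moreover have "y * k \<le> k ^ n * k" using y k0 by (intro mult_right_mono) auto
    moreover have "y * k \<le> y" using y k by (simp add: mult_left_le)
    moreover have "0 \<le> z" unfolding z_def using y assms by simp
    moreover have "(smoothstep ^^ Suc n) (of_real x) = of_real z"
      using y by (simp add: smoothstep_def z_def power2_eq_square mult.assoc)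
    ultimately show ?case using y by (intro exI[of _ z]) (auto simp: mult.commute)
  qed
  have "norm ((smoothstep ^^ n) (of_real x)) \<le> k ^ n" for n
    using *[of n] by auto
  then have "\<forall>\<^sub>F n in sequentially. norm ((smoothstep ^^ n) (of_real x)) \<le> k ^ n"
    by (rule eventuallyI)
  moreover have "(\<lambda>n. k ^ n) \<longlonglongrightarrow> 0" using k k0 by (intro LIMSEQ_power_zero) auto
  ultimately show ?thesis
    by (rule Lim_null_comparison)
qed

lemma smoothstep_iterate_tendsto_1:
  assumes "1/2 < x" "x \<le> (1::real)"
  shows "(\<lambda>n. (smoothstep ^^ n) (of_real x)) \<longlonglongrightarrow> 1"
proof -
  have "(\<lambda>n. 1 - (smoothstep ^^ n) (of_real (1 - x))) \<longlonglongrightarrow> 1 - 0"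
    using assms by (intro tendsto_diff tendsto_const smoothstep_iterate_tendsto_0) auto
  then show ?thesis by (simp add: smoothstep_iterate_reflect)
qed

section \<open>Separability in the sup norm on a compact set\<close>

text \<open>
  A function \<open>f\<close> is recorded, up to a given error, by finitely many pairs \<open>(U, V)\<close> of basic open sets
  such that the sets \<open>U\<close> cover \<open>K\<close>, the image of \<open>K \<inter> U\<close> lies in \<open>V\<close>, and \<open>V\<close> is small. There are only
  countably many finite records, and two functions with the same record are close. Choosing a member
  of \<open>X\<close> for every record that occurs gives a countable dense subset inside \<open>X\<close> itself,
  for an arbitrary set \<open>X\<close> of continuous functions.
\<close>
lemma separable_continuous_functions_on_compact:
  fixes X :: "('a::second_countable_topology \<Rightarrow> 'b::{second_countable_topology,metric_space}) set"
  assumes K: "compact K" and cont: "\<And>f. f \<in> X \<Longrightarrow> continuous_on K f"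
  obtains D where "countable D" "D \<subseteq> X"
    "\<And>f e. f \<in> X \<Longrightarrow> e > 0 \<Longrightarrow> \<exists>g\<in>D. \<forall>z\<in>K. dist (g z) (f z) < e"
proof -
  obtain A :: "'a set set" where A: "countable A" "topological_basis A"
    using ex_countable_basis by blast
  obtain B :: "'b set set" where B: "countable B" "topological_basis B"
    using ex_countable_basis by blast
  define fits where "fits P f \<longleftrightarrow>
    K \<subseteq> \<Union>(fst ` P) \<and> (\<forall>p\<in>P. f ` (K \<inter> fst p) \<subseteq> snd p)" for P and f :: "'a \<Rightarrow> 'b"
  define \<P> where "\<P> = {P. finite P \<and> P \<subseteq> A \<times> B}"
  define \<Q> where "\<Q> = {P \<in> \<P>. \<exists>f\<in>X. fits P f}"
  define h where "h P = (SOME f. f \<in> X \<and> fits P f)" for P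
  have h: "h P \<in> X" "fits P (h P)" if "P \<in> \<Q>" for P
  proof -
    have "\<exists>f. f \<in> X \<and> fits P f" using that by (auto simp: \<Q>_def)
    then have "h P \<in> X \<and> fits P (h P)"
      unfolding h_def by (rule someI_ex)
    then show "h P \<in> X" "fits P (h P)" by auto
  qed
  have "countable \<P>" unfolding \<P>_def using A B by (intro countable_Collect_finite_subset) auto
  then have "countable (h ` \<Q>)" unfolding \<Q>_def by (intro countable_image) auto
  moreover have "h ` \<Q> \<subseteq> X" using h by auto
  moreover have "\<exists>g\<in>h ` \<Q>. \<forall>z\<in>K. dist (g z) (f z) < e" if f: "f \<in> X" and e: "e > 0" for f e
  proof -
    have "\<exists>U\<in>A. \<exists>V\<in>B. x \<in> U \<and> f ` (K \<inter> U) \<subseteq> V \<and> V \<subseteq> ball (f x) (e/2)" if x: "x \<in> K" for x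
    proof -
      obtain V where V: "V \<in> B" "f x \<in> V" "V \<subseteq> ball (f x) (e/2)"
        by (rule topological_basisE[OF B(2) open_ball, of "f x" "f x" "e/2"]) (use e in auto)
      have "open V" using B(2) V(1) by (rule topological_basis_open)
      then obtain W where W: "open W" "W \<inter> K = f -` V \<inter> K"
        using cont[OF f] unfolding continuous_on_open_invariant by blast
      then have "x \<in> W" using x V by auto
      then obtain U where "U \<in> A" "x \<in> U" "U \<subseteq> W"
        by (rule topological_basisE[OF A(2) W(1)])
      then show ?thesis using V W by blast
    qed
    then obtain U V where "\<And>x. x \<in> K \<Longrightarrow> U x \<in> A \<and> V x \<in> B \<and> x \<in> U x \<and>
        f ` (K \<inter> U x) \<subseteq> V x \<and> V x \<subseteq> ball (f x) (e/2)"
      by metis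
    then have U: "U x \<in> A" "x \<in> U x" and V: "V x \<in> B" "V x \<subseteq> ball (f x) (e/2)"
      and UV: "\<And>z. z \<in> K \<Longrightarrow> z \<in> U x \<Longrightarrow> f z \<in> V x" if "x \<in> K" for x
      using that by blast+
    have op: "\<And>x. x \<in> K \<Longrightarrow> open (U x)" using U topological_basis_open[OF A(2)] by blast
    obtain C where C: "C \<subseteq> K" "finite C" "K \<subseteq> (\<Union>x\<in>C. U x)"
      by (rule compactE_image[OF K, of K U]) (use op U in auto)
    define P where "P = (\<lambda>x. (U x, V x)) ` C"
    have "f z \<in> V x" if "x \<in> C" "z \<in> K" "z \<in> U x" for x z
      using UV[of x z] C(1) that by blast
    then have "fits P f" unfolding fits_def P_def using C(3) by auto
    moreover have "P \<in> \<P>" unfolding \<P>_def P_def using C U V by auto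
    ultimately have PQ: "P \<in> \<Q>" unfolding \<Q>_def using f by blast
    have "dist (h P z) (f z) < e" if z: "z \<in> K" for z
    proof -
      obtain x where x: "x \<in> C" "z \<in> U x" using C z by blast
      have "h P z \<in> V x" using h(2)[OF PQ] x z unfolding fits_def P_def by auto
      moreover have "f z \<in> V x" using UV x C z by auto
      moreover have "V x \<subseteq> ball (f x) (e/2)" using V x C by blast
      ultimately have "h P z \<in> ball (f x) (e/2)" "f z \<in> ball (f x) (e/2)"
        by blast+
      then show ?thesis by (simp add: dist_commute dist_triangle_half_r)
    qed
    then show ?thesis using PQ by blast
  qed
  ultimately show ?thesis by (rule that)
qed

section \<open>Limits of functions without critical points\<close>

text \<open>
  Near \<open>z0\<close> the derivatives converge uniformly, by Cauchy's estimate. By Hurwitz's theorem their limit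
  \<open>deriv g\<close> either has no zero there or is constant. If it is constant and vanishes at \<open>z0\<close>, then \<open>g\<close>
  is constant near \<open>z0\<close>, hence on all of \<open>S\<close>.
\<close>
lemma Hurwitz_deriv_nonzero:
  assumes S: "open S" "connected S"
    and hol: "\<And>n::nat. F n holomorphic_on S" and nz: "\<And>n z. z \<in> S \<Longrightarrow> deriv (F n) z \<noteq> 0"
    and g: "g holomorphic_on S"
    and lim: "\<And>K. compact K \<Longrightarrow> K \<subseteq> S \<Longrightarrow> uniform_limit K F g sequentially"
    and nonconst: "\<not> g constant_on S" and z0: "z0 \<in> S"
  shows "deriv g z0 \<noteq> 0"
proof
  assume 0: "deriv g z0 = 0"
  obtain r where r: "r > 0" "cball z0 (2 * r) \<subseteq> S"
  proof -
    obtain e where "e > 0" "cball z0 e \<subseteq> S" using S(1) z0 open_contains_cball by blast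
    then show ?thesis using that[of "e/2"] by simp
  qed
  have sub: "cball w r \<subseteq> cball z0 (2 * r)" if "w \<in> ball z0 r" for w
    using that by (intro subsetI) (smt (verit) dist_triangle mem_ball mem_cball)
  have bS: "ball z0 r \<subseteq> S" using r by (smt (verit) mem_ball mem_cball subset_iff)
  have ul: "uniform_limit (ball z0 r) (\<lambda>n. deriv (F n)) (deriv g) sequentially"
  proof (rule uniform_limitI)
    fix e :: real assume e: "e > 0"
    have "\<forall>\<^sub>F n in sequentially. \<forall>x\<in>cball z0 (2 * r). dist (F n x) (g x) < e * r / 2"
      using lim[OF _ r(2)] e r(1) by (intro uniform_limitD) auto
    then show "\<forall>\<^sub>F n in sequentially. \<forall>w\<in>ball z0 r. dist (deriv (F n) w) (deriv g w) < e"
    proof eventually_elim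
      case (elim n)
      show ?case
      proof
        fix w assume w: "w \<in> ball z0 r"
        have cb: "cball w r \<subseteq> S" using sub[OF w] r by blast
        have h: "(\<lambda>z. F n z - g z) holomorphic_on cball w r"
          using hol g cb by (intro holomorphic_intros) (auto intro: holomorphic_on_subset)
        have "norm ((deriv ^^ 1) (\<lambda>z. F n z - g z) w) \<le> fact 1 * (e * r / 2) / r ^ 1"
        proof (rule Cauchy_inequality)
          show "norm (F n x - g x) \<le> e * r / 2" if "norm (w - x) = r" for x
          proof -
            have "x \<in> cball w r" using that by (simp add: dist_norm)
            then show ?thesis using elim sub[OF w] by (fastforce simp: dist_norm)
          qed
        qed (use h r in \<open>auto intro: holomorphic_on_subset holomorphic_on_imp_continuous_on\<close>)
        moreover have "deriv (\<lambda>z. F n z - g z) w = deriv (F n) w - deriv g w"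
        proof -
          have "w \<in> S" using w bS by blast
          then show ?thesis
            using hol g S(1) by (intro deriv_diff) (auto intro: holomorphic_on_imp_differentiable_at)
        qed
        ultimately have "norm (deriv (F n) w - deriv g w) \<le> e / 2"
          using r(1) by simp
        then show "dist (deriv (F n) w) (deriv g w) < e" using e by (simp add: dist_norm)
      qed
    qed
  qed
  have gd: "(g has_field_derivative deriv g z) (at z)" if "z \<in> ball z0 r" for z
    using that bS g S(1) holomorphic_derivI by blast
  have "deriv g constant_on ball z0 r"
  proof (rule ccontr)
    assume nc: "\<not> deriv g constant_on ball z0 r"
    have "deriv g z0 \<noteq> 0"
    proof (rule Hurwitz_no_zeros[where S = "ball z0 r" and \<F> = "\<lambda>n. deriv (F n)" and g = "deriv g"])
      show "\<And>n. deriv (F n) holomorphic_on ball z0 r" "deriv g holomorphic_on ball z0 r"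
        using hol g S(1) bS by (auto intro: holomorphic_deriv holomorphic_on_subset)
      show "uniform_limit K (\<lambda>n. deriv (F n)) (deriv g) sequentially" if "K \<subseteq> ball z0 r" for K
        using uniform_limit_on_subset[OF ul that] .
    qed (use nc nz bS r in auto)
    with 0 show False by simp
  qed
  then have "deriv g z = 0" if "z \<in> ball z0 r" for z
    using 0 that r(1) unfolding constant_on_def by (metis centre_in_ball)
  then obtain c where c: "\<forall>z\<in>ball z0 r. g z = c"
    using has_field_derivative_zero_constant[of "ball z0 r" g] gd
    by (metis convex_ball has_field_derivative_at_within)
  have "g z - c = 0" if "z \<in> S" for z
  proof (rule analytic_continuation_open[where s = "ball z0 r" and s' = S and f = "\<lambda>z. g z - c" and g = "\<lambda>_. 0"])
    show "(\<lambda>z. g z - c) holomorphic_on S" using g by (intro holomorphic_intros)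
  qed (use that S bS c r in auto)
  then show False using nonconst unfolding constant_on_def by auto
qed

section \<open>Primitives of exponentials\<close>

text \<open>
  Writing derivatives as exponentials turns the open condition \<open>f' \<noteq> 0\<close> into no condition at all:
  the logarithms \<open>g\<close> of derivatives may be combined freely.
\<close>
lemma noncritical_on_exp_derivative:
  assumes S: "open S" "convex S" "a \<in> S" and f: "noncritical_on S f"
  obtains g where "g holomorphic_on S" "\<And>z. z \<in> S \<Longrightarrow> (f has_field_derivative exp (g z)) (at z)"
proof -
  have hol: "f holomorphic_on S" using f by (simp add: noncritical_on_def)
  have "deriv f holomorphic_on S" using hol S(1) by (rule holomorphic_deriv)
  moreover have "deriv f z \<noteq> 0" if "z \<in> S" for z using f that by (simp add: noncritical_on_def)
  ultimately obtain g where g: "g holomorphic_on S" "\<And>z. z \<in> S \<Longrightarrow> exp (g z) = deriv f z"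
    using holomorphic_logarithm_exists[OF S(2,1) _ _ S(3)] by blast
  then show ?thesis using that holomorphic_derivI[OF hol S(1)] by metis
qed

lemma noncritical_primitive_exp:
  assumes S: "open S" "convex S" and g: "g holomorphic_on S"
  obtains F where "F a = c" "\<And>z. z \<in> S \<Longrightarrow> (F has_field_derivative exp (g z)) (at z)"
    "noncritical_on S F"
proof -
  have "(\<lambda>z. exp (g z)) holomorphic_on S" using g by (intro holomorphic_intros)
  then obtain G where G: "\<And>z. z \<in> S \<Longrightarrow> (G has_field_derivative exp (g z)) (at z within S)"
    using holomorphic_convex_primitive'[OF S(2,1)] by blast
  define F where "F z = G z - G a + c" for z
  have F: "(F has_field_derivative exp (g z)) (at z)" if "z \<in> S" for z
  proof -
    have "(G has_field_derivative exp (g z)) (at z)"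
      using G[OF that] at_within_open[OF that S(1)] by simp
    then show ?thesis unfolding F_def by (auto intro!: derivative_eq_intros)
  qed
  have "noncritical_on S F"
    unfolding noncritical_on_def
  proof
    show "F holomorphic_on S" using F S(1) by (auto simp: holomorphic_on_open)
    show "\<forall>z\<in>S. deriv F z \<noteq> 0" using DERIV_imp_deriv[OF F] by simp
  qed
  then show ?thesis using that[of F] F by (simp add: F_def)
qed

lemma uniform_limit_exp:
  fixes g :: "'a \<Rightarrow> complex"
  assumes u: "uniform_limit K u g F" and b: "bounded (g ` K)"
  shows "uniform_limit K (\<lambda>n z. exp (u n z)) (\<lambda>z. exp (g z)) F"
proof -
  obtain M where M: "\<And>z. z \<in> K \<Longrightarrow> norm (g z) \<le> M" using b unfolding bounded_iff by auto
  have "uniformly_continuous_on (cball 0 (M + 1)) (exp :: complex \<Rightarrow> complex)"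
    by (intro compact_uniformly_continuous continuous_intros compact_cball)
  moreover have "\<forall>\<^sub>F n in F. \<forall>z\<in>K. u n z \<in> cball 0 (M + 1)"
    using uniform_limitD[OF u zero_less_one]
  proof eventually_elim
    case (elim n)
    show ?case
    proof
      fix z assume z: "z \<in> K"
      have "norm (u n z) \<le> norm (g z) + dist (u n z) (g z)"
        by (metis dist_norm norm_triangle_sub)
      also have "\<dots> \<le> M + 1" using M[OF z] elim z by (intro add_mono) (auto intro: less_imp_le)
      finally show "u n z \<in> cball 0 (M + 1)" by simp
    qed
  qed
  ultimately show ?thesis using uniform_limit_compose_uniformly_continuous_on[OF u] by blast
qed

lemma uniform_limit_of_derivatives:
  fixes F :: "nat \<Rightarrow> complex \<Rightarrow> complex"
  assumes K: "convex K" "bounded K" "a \<in> K"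
    and F: "\<And>n z. z \<in> K \<Longrightarrow> (F n has_field_derivative h n z) (at z)"
    and f: "\<And>z. z \<in> K \<Longrightarrow> (f has_field_derivative k z) (at z)"
    and h: "uniform_limit K h k sequentially" and a: "(\<lambda>n. F n a) \<longlonglongrightarrow> f a"
  shows "uniform_limit K F f sequentially"
proof (rule uniform_limitI)
  fix e :: real assume e: "e > 0"
  obtain B where B: "B > 0" "\<And>z. z \<in> K \<Longrightarrow> norm (z - a) \<le> B"
  proof -
    obtain B where "\<And>z. z \<in> K \<Longrightarrow> dist a z \<le> B"
      using K(2) bounded_any_center[of K a] by blast
    then show ?thesis using that[of "max B 1"]
      by (simp add: dist_norm norm_minus_commute le_max_iff_disj)
  qed
  have "\<forall>\<^sub>F n in sequentially. dist (F n a) (f a) < e / 2"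
    using a e by (intro tendstoD) auto
  moreover have "\<forall>\<^sub>F n in sequentially. \<forall>z\<in>K. dist (h n z) (k z) < e / (2 * B)"
    using h e B by (intro uniform_limitD) auto
  ultimately show "\<forall>\<^sub>F n in sequentially. \<forall>z\<in>K. dist (F n z) (f z) < e"
  proof eventually_elim
    case (elim n)
    show ?case
    proof
      fix z assume z: "z \<in> K"
      define G where "G w = F n w - f w" for w
      have "norm (G z - G a) \<le> e / (2 * B) * norm (z - a)"
      proof (rule field_differentiable_bound[OF K(1)])
        fix w assume w: "w \<in> K"
        show "(G has_field_derivative (h n w - k w)) (at w within K)"
          unfolding G_def using F[OF w] f[OF w]
          by (intro DERIV_diff) (auto intro: has_field_derivative_at_within)
        show "norm (h n w - k w) \<le> e / (2 * B)"
          using elim w by (auto simp: dist_norm intro: less_imp_le)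
      qed (use z K in auto)
      also have "\<dots> \<le> e / (2 * B) * B"
        using B(2)[OF z] B(1) e by (intro mult_left_mono) auto
      also have "\<dots> = e / 2" using B by simp
      finally have "norm (G z - G a) \<le> e / 2" .
      moreover have "norm (G a) < e / 2" using elim by (simp add: G_def dist_norm)
      moreover have "norm (G z) \<le> norm (G a) + norm (G z - G a)" by (rule norm_triangle_sub)
      ultimately show "dist (F n z) (f z) < e" by (simp add: G_def dist_norm)
    qed
  qed
qed

text \<open>
  An increment of a primitive is an integral of its derivative, so this is dominated convergence.
  Pointwise convergence is required only inside the interval, because the limits of the step
  polynomials jump at the points where consecutive intervals meet.
\<close>
lemma increments_tendsto:
  fixes F :: "nat \<Rightarrow> complex \<Rightarrow> complex" and h :: "nat \<Rightarrow> real \<Rightarrow> complex"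
  assumes ab: "a \<le> b"
    and F: "\<And>n x. x \<in> {a..b} \<Longrightarrow> (F n has_field_derivative h n x) (at (of_real x))"
    and f: "\<And>x. x \<in> {a..b} \<Longrightarrow> (f has_field_derivative k x) (at (of_real x))"
    and M: "\<And>n x. x \<in> {a..b} \<Longrightarrow> norm (h n x) \<le> M"
    and lim: "\<And>x. a < x \<Longrightarrow> x < b \<Longrightarrow> (\<lambda>n. h n x) \<longlonglongrightarrow> k x"
  shows "(\<lambda>n. F n (of_real b) - F n (of_real a)) \<longlonglongrightarrow> f (of_real b) - f (of_real a)"
proof -
  have ftc: "(h' has_integral G (of_real b) - G (of_real a)) {a<..<b}"
    if G: "\<And>x. x \<in> {a..b} \<Longrightarrow> (G has_field_derivative h' x) (at (of_real x))"
    for G :: "complex \<Rightarrow> complex" and h'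
  proof -
    have "(h' has_integral G (of_real b) - G (of_real a)) {a..b}"
      by (rule fundamental_theorem_of_calculus[OF ab, of "\<lambda>x. G (of_real x)" h'])
        (rule has_vector_derivative_real_field[OF G])
    then show ?thesis by (rule iffD1[OF has_integral_Icc_iff_Ioo])
  qed
  have hF: "(h n has_integral F n (of_real b) - F n (of_real a)) {a<..<b}" for n
    by (rule ftc[of "F n" "h n"]) (rule F)
  have "(\<lambda>n. integral {a<..<b} (h n)) \<longlonglongrightarrow> integral {a<..<b} k"
  proof (rule dominated_convergence(2)[where h = "\<lambda>_. M"])
    show "(\<lambda>_. M) integrable_on {a<..<b}"
      by (rule iffD1[OF integrable_on_Icc_iff_Ioo]) (rule integrable_continuous_interval, simp)
    show "h n integrable_on {a<..<b}" for n using hF by (rule has_integral_integrable)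
  qed (use M lim in auto)
  moreover have "integral {a<..<b} k = f (of_real b) - f (of_real a)"
    by (rule integral_unique) (rule ftc[of f k], rule f)
  moreover have "integral {a<..<b} (h n) = F n (of_real b) - F n (of_real a)" for n
    using hF by (rule integral_unique)
  ultimately show ?thesis by simp
qed

lemma uniform_limit_blend:
  fixes p q :: "'a \<Rightarrow> complex"
  assumes "uniform_limit K \<alpha> (\<lambda>_. a) F" "uniform_limit K \<beta> (\<lambda>_. b) F"
    and "bounded (p ` K)" "bounded (q ` K)"
  shows "uniform_limit K (\<lambda>n z. p z * (1 - \<alpha> n z) + c * (\<alpha> n z - \<beta> n z) + q z * \<beta> n z)
    (\<lambda>z. p z * (1 - a) + c * (a - b) + q z * b) F"
proof -
  have bd: "bounded ((\<lambda>_. d) ` K)" for d :: complex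
    by (rule finite_imp_bounded) (rule finite_subset[of _ "{d}"], auto)
  show ?thesis
    by (intro uniform_limit_add uniform_lim_mult uniform_limit_minus uniform_limit_const assms bd)
qed

lemma uniform_limit_geometric:
  fixes w :: complex
  assumes "\<And>n z. z \<in> K \<Longrightarrow> norm (\<alpha> n z - w) \<le> (1/2)^n"
  shows "uniform_limit K \<alpha> (\<lambda>_. w) sequentially"
proof (rule uniform_limitI)
  fix e :: real assume "e > 0"
  have "(\<lambda>n. (1/2::real)^n) \<longlonglongrightarrow> 0" by (intro LIMSEQ_power_zero) simp
  then have "\<forall>\<^sub>F n in sequentially. (1/2::real)^n < e"
    using \<open>e > 0\<close> by (rule order_tendstoD(2))
  then show "\<forall>\<^sub>F n in sequentially. \<forall>z\<in>K. dist (\<alpha> n z) w < e"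
  proof eventually_elim
    case (elim n)
    show ?case
      unfolding dist_norm using assms elim by (blast intro: le_less_trans)
  qed
qed

section \<open>Blending two functions at a large distance\<close>

text \<open>
  The central approximation step. Write \<open>f\<^sub>1' = exp g\<^sub>1\<close> and \<open>f\<^sub>2' = exp g\<^sub>2\<close>, and look for \<open>F\<close> with
  \<open>F' = exp u\<close> and \<open>F 0 = f\<^sub>1 0\<close>. If \<open>u\<close> is close to \<open>g\<^sub>1\<close> on \<open>K\<close> and close to \<open>g\<^sub>2 (z - T)\<close> on \<open>K + T\<close>,
  then \<open>F\<close> is as wanted up to an additive error on \<open>K + T\<close>, which is governed by the integral of
  \<open>exp u\<close> over \<open>[0, T]\<close>. To control that integral, \<open>u\<close> passes from \<open>g\<^sub>1\<close> to \<open>g\<^sub>2 (z - T)\<close> through a constant \<open>c\<close>: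
  on \<open>[0, T]\<close> it converges to \<open>g\<^sub>1\<close> before \<open>T / 2\<close>, to \<open>c\<close> between \<open>T / 2\<close> and \<open>s\<close>, and to
  \<open>g\<^sub>2 (z - T)\<close> after \<open>s\<close>. The middle piece contributes \<open>exp c * (s - T / 2)\<close>, which can be any
  nonzero number, so a suitable \<open>c\<close> corrects the value of \<open>F T\<close>.

  Both steps come from the iterates of \<open>smoothstep\<close>: \<open>\<alpha>\<close> applies them to \<open>z / T\<close> and \<open>\<beta>\<close> to
  \<open>(z / T)\<^sup>2\<close>. Squaring fixes \<open>0\<close> and \<open>1\<close> but moves the step from \<open>T / 2\<close> to \<open>s = T * sqrt (1/2)\<close>.
\<close>
lemma noncritical_blend_translates:
  assumes S: "open S" "convex S" "0 \<in> S"
    and trans: "\<And>z t. z \<in> S \<Longrightarrow> z + of_real t \<in> S"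
    and f: "noncritical_on S f\<^sub>1" "noncritical_on S f\<^sub>2"
    and K: "compact K" "K \<subseteq> S" and e: "e > 0"
  obtains T F where "noncritical_on S F" "\<And>z. z \<in> K \<Longrightarrow> dist (F z) (f\<^sub>1 z) < e"
    "\<And>z. z \<in> K \<Longrightarrow> dist (F (z + of_real T)) (f\<^sub>2 z) < e"
proof -
  obtain g\<^sub>1 where g\<^sub>1: "g\<^sub>1 holomorphic_on S"
    and f\<^sub>1: "\<And>z. z \<in> S \<Longrightarrow> (f\<^sub>1 has_field_derivative exp (g\<^sub>1 z)) (at z)"
    using noncritical_on_exp_derivative[OF S f(1)] by blast
  obtain g\<^sub>2 where g\<^sub>2: "g\<^sub>2 holomorphic_on S"
    and f\<^sub>2: "\<And>z. z \<in> S \<Longrightarrow> (f\<^sub>2 has_field_derivative exp (g\<^sub>2 z)) (at z)"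
    using noncritical_on_exp_derivative[OF S f(2)] by blast
  \<comment> \<open>Comparing functions through their derivatives needs convexity and a common base point \<open>0\<close>.\<close>
  define L where "L = convex hull (insert 0 K)"
  have L: "compact L" "convex L" "0 \<in> L" "K \<subseteq> L"
    unfolding L_def using K by (auto intro: compact_convex_hull hull_inc)
  have LS: "L \<subseteq> S" unfolding L_def using S K by (intro hull_minimal) auto
  obtain R where R: "R > 0" "\<And>z. z \<in> L \<Longrightarrow> norm z \<le> R"
    using compact_imp_bounded[OF L(1)] unfolding bounded_pos by blast
  \<comment> \<open>With this \<open>T\<close> the set \<open>L / T\<close> has radius at most \<open>1/20\<close>; then \<open>z / T\<close> and its square stay within
    \<open>1/8\<close> of \<open>0\<close> on \<open>L\<close>, and within \<open>1/8\<close> of \<open>1\<close> on \<open>L + T\<close>.\<close>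
  define T where "T = 20 * R"
  define s where "s = T * sqrt (1/2)"
  have T0: "T > 0" using R by (simp add: T_def)
  have "1/2 < sqrt (1/2)" by (rule real_less_rsqrt) (simp add: power2_eq_square)
  then have Ts: "T / 2 < s" using T0 by (simp add: s_def field_simps)
  have "sqrt (1/2) < 1" by simp
  then have sT: "s < T" using T0 by (simp add: s_def)
  have s2: "(s / T)\<^sup>2 = 1/2" using T0 by (simp add: s_def)
  have small: "norm (z / of_real T) \<le> 1/20" if "z \<in> L" for z
    using R(2)[OF that] R(1) by (simp add: T_def norm_divide field_simps)
  have real_S: "of_real x \<in> S" for x using trans[OF S(3), of x] by simp
  have minus_S: "z - of_real T \<in> S" if "z \<in> S" for z
    using trans[OF that, of "- T"] by simp

  define \<alpha> where "\<alpha> n z = (smoothstep ^^ n) (z / of_real T)" for n z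
  define \<beta> where "\<beta> n z = (smoothstep ^^ n) ((z / of_real T)\<^sup>2)" for n z
  define d where "d = s - T / 2"
  have d: "d > 0" using Ts by (simp add: d_def)
  define m where "m = f\<^sub>2 (of_real (s - T)) - f\<^sub>1 (of_real (T / 2))"
  \<comment> \<open>\<open>m\<close> is the increment that the middle piece should contribute. If it vanishes, no exponential
    attains it, and a small positive increment is used instead.\<close>
  obtain c where c: "norm (exp c * of_real d - m) < e / 2"
  proof (cases "m = 0")
    case True
    show ?thesis
    proof (rule that[of "of_real (ln (e / (4 * d)))"])
      have "exp (ln (e / (4 * d))) = e / (4 * d)" using d e by simp
      then have "exp (complex_of_real (ln (e / (4 * d)))) = of_real (e / (4 * d))"
        by (simp only: exp_of_real)
      then have "exp (complex_of_real (ln (e / (4 * d)))) * of_real d - m = of_real (e / 4)"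
        using d True by simp
      then show "norm (exp (complex_of_real (ln (e / (4 * d)))) * of_real d - m) < e / 2"
        using e by (simp del: of_real_divide)
    qed
  next
    case False
    then show ?thesis using that[of "Ln (m / of_real d)"] d e by simp
  qed
  define err where "err = exp c * of_real d - m"
  define u where "u n z = g\<^sub>1 z * (1 - \<alpha> n z) + c * (\<alpha> n z - \<beta> n z) + g\<^sub>2 (z - of_real T) * \<beta> n z" for n z
  have holchi: "(\<lambda>z. (smoothstep ^^ n) (p z)) holomorphic_on S" if "p holomorphic_on S" for p n
    using holomorphic_on_compose[OF that holomorphic_smoothstep_iterate[of n]] by (simp add: o_def)
  have hol2: "(\<lambda>z. g\<^sub>2 (z - of_real T)) holomorphic_on S"
  proof -
    have "(\<lambda>z. z - of_real T) holomorphic_on S" by (intro holomorphic_intros)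
    then have "(g\<^sub>2 \<circ> (\<lambda>z. z - of_real T)) holomorphic_on S"
      using g\<^sub>2 minus_S by (intro holomorphic_on_compose_gen) auto
    then show ?thesis by (simp add: o_def)
  qed
  have u_hol: "u n holomorphic_on S" for n
    unfolding u_def \<alpha>_def \<beta>_def using T0
    by (intro holomorphic_intros holchi g\<^sub>1 hol2) auto
  have "\<forall>n. \<exists>F. F 0 = f\<^sub>1 0 \<and> (\<forall>z\<in>S. (F has_field_derivative exp (u n z)) (at z)) \<and> noncritical_on S F"
    by (intro allI) (metis noncritical_primitive_exp[OF S(1,2) u_hol])
  then obtain F where F0: "\<And>n. F n 0 = f\<^sub>1 0"
    and F: "\<And>n z. z \<in> S \<Longrightarrow> (F n has_field_derivative exp (u n z)) (at z)"
    and Fnc: "\<And>n. noncritical_on S (F n)"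
    by metis

  have shift_cont: "continuous_on A (\<lambda>z. h (z + of_real t))"
    if "h holomorphic_on S" "A \<subseteq> S" for h A t
    using that trans
    by (intro continuous_on_compose2[OF holomorphic_on_imp_continuous_on[OF that(1)]] continuous_intros) auto
  have bd: "bounded ((\<lambda>z. h (z + of_real t)) ` A)"
    if "h holomorphic_on S" "A \<subseteq> S" "compact A" for h t A
    using compact_continuous_image[OF shift_cont[OF that(1,2)] that(3)] by (rule compact_imp_bounded)

  have lim_f\<^sub>1: "uniform_limit L F f\<^sub>1 sequentially"
  proof (rule uniform_limit_of_derivatives[where a = 0])
    have "uniform_limit L \<alpha> (\<lambda>_. 0) sequentially"
    proof (rule uniform_limit_geometric)
      fix n z assume "z \<in> L"
      then have "norm (z / of_real T) \<le> 1/8" using small[of z] by simp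
      then show "norm (\<alpha> n z - 0) \<le> (1/2) ^ n"
        unfolding \<alpha>_def using norm_smoothstep_iterate_near_0 by simp
    qed
    moreover have "uniform_limit L \<beta> (\<lambda>_. 0) sequentially"
    proof (rule uniform_limit_geometric)
      fix n z assume "z \<in> L"
      then have "norm (z / of_real T) * norm (z / of_real T) \<le> (1/20) * (1/20)"
        using small by (intro mult_mono) auto
      also have "\<dots> \<le> (1/8 :: real)" by simp
      finally have "norm ((z / of_real T)\<^sup>2) \<le> 1/8"
        by (simp only: norm_mult power2_eq_square)
      then show "norm (\<beta> n z - 0) \<le> (1/2) ^ n"
        unfolding \<beta>_def using norm_smoothstep_iterate_near_0 by simp
    qed
    ultimately have "uniform_limit L u g\<^sub>1 sequentially"
      using uniform_limit_blend[where K = L and F = sequentially and \<alpha> = \<alpha> and a = 0 and \<beta> = \<beta> and b = 0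
          and p = g\<^sub>1 and q = "\<lambda>z. g\<^sub>2 (z - of_real T)" and c = c]
        bd[OF g\<^sub>1 LS L(1), of 0] bd[OF g\<^sub>2 LS L(1), of "- T"]
      by (simp add: u_def[abs_def])
    moreover have "bounded (g\<^sub>1 ` L)" using bd[OF g\<^sub>1 LS L(1), of 0] by simp
    ultimately show "uniform_limit L (\<lambda>n z. exp (u n z)) (\<lambda>z. exp (g\<^sub>1 z)) sequentially"
      by (rule uniform_limit_exp)
  qed (use L LS F f\<^sub>1 F0 in \<open>auto intro: compact_imp_bounded\<close>)

  have bound: "\<exists>M. \<forall>n. \<forall>x\<in>{0..T}. norm (exp (u n (of_real x))) \<le> M"
  proof -
    have seg: "of_real ` {0..T} \<subseteq> S" "compact (of_real ` {0..T} :: complex set)"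
      using real_S by (auto intro!: compact_continuous_image continuous_intros)
    obtain B\<^sub>1 where B\<^sub>1: "\<forall>x\<in>{0..T}. norm (g\<^sub>1 (of_real x)) \<le> B\<^sub>1"
      using bd[OF g\<^sub>1 seg, of 0] unfolding bounded_iff by auto
    obtain B\<^sub>2 where B\<^sub>2: "\<forall>x\<in>{0..T}. norm (g\<^sub>2 (of_real x - of_real T)) \<le> B\<^sub>2"
      using bd[OF g\<^sub>2 seg, of "- T"] unfolding bounded_iff by auto
    have "norm (exp (u n (of_real x))) \<le> exp (B\<^sub>1 * 2 + norm c * 2 + B\<^sub>2 * 1)" if x: "x \<in> {0..T}" for n x
    proof -
      have x01: "0 \<le> x / T" "x / T \<le> 1" using x T0 by auto
      have "norm (\<alpha> n (of_real x)) \<le> 1"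
        using norm_smoothstep_iterate_unit_interval[OF x01] by (simp add: \<alpha>_def)
      moreover have "norm (\<beta> n (of_real x)) \<le> 1"
        using norm_smoothstep_iterate_unit_interval[of "(x / T)\<^sup>2" n] x01
        by (simp add: \<beta>_def power_le_one)
      ultimately have ab: "norm (1 - \<alpha> n (of_real x)) \<le> 2" "norm (\<alpha> n (of_real x) - \<beta> n (of_real x)) \<le> 2"
        "norm (\<beta> n (of_real x)) \<le> 1"
        using norm_triangle_ineq4[of 1 "\<alpha> n (of_real x)"]
          norm_triangle_ineq4[of "\<alpha> n (of_real x)" "\<beta> n (of_real x)"] by auto
      have "norm (u n (of_real x)) \<le> norm (g\<^sub>1 (of_real x)) * norm (1 - \<alpha> n (of_real x)) +
          norm c * norm (\<alpha> n (of_real x) - \<beta> n (of_real x)) +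
          norm (g\<^sub>2 (of_real x - of_real T)) * norm (\<beta> n (of_real x))"
        unfolding u_def norm_mult[symmetric]
        by (intro order_trans[OF norm_triangle_ineq] add_right_mono norm_triangle_ineq)
      also have "\<dots> \<le> B\<^sub>1 * 2 + norm c * 2 + B\<^sub>2 * 1"
        using ab B\<^sub>1[rule_format, OF x] B\<^sub>2[rule_format, OF x] order_trans[OF norm_ge_zero B\<^sub>1[rule_format, OF x]] order_trans[OF norm_ge_zero B\<^sub>2[rule_format, OF x]]
        by (intro add_mono mult_mono) auto
      finally have "exp (norm (u n (of_real x))) \<le> exp (B\<^sub>1 * 2 + norm c * 2 + B\<^sub>2 * 1)" by simp
      with norm_exp[of "u n (of_real x)"] show ?thesis by (rule order_trans)
    qed
    then show ?thesis by blast
  qed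
  then obtain M where M: "\<And>n x. x \<in> {0..T} \<Longrightarrow> norm (exp (u n (of_real x))) \<le> M" by blast

  have u_lim: "(\<lambda>n. exp (u n (of_real x))) \<longlonglongrightarrow> exp (g\<^sub>1 (of_real x) * (1 - a) + c * (a - b) + g\<^sub>2 (of_real x - of_real T) * b)"
    if "(\<lambda>n. (smoothstep ^^ n) (of_real (x / T))) \<longlonglongrightarrow> a"
       "(\<lambda>n. (smoothstep ^^ n) (of_real ((x / T)\<^sup>2))) \<longlonglongrightarrow> b" for x a b
    unfolding u_def \<alpha>_def \<beta>_def using that by (intro tendsto_intros) (simp_all add: power_divide)
  have sq_less: "(x / T)\<^sup>2 < 1/2" if "0 \<le> x" "x < s" for x
  proof -
    have "(x / T)\<^sup>2 < (s / T)\<^sup>2"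
      using that T0 by (intro power_strict_mono divide_strict_right_mono) auto
    then show ?thesis by (simp add: s2)
  qed
  have sq_greater: "1/2 < (x / T)\<^sup>2" if "s < x" for x
  proof -
    have "(s / T)\<^sup>2 < (x / T)\<^sup>2"
      using that T0 Ts by (intro power_strict_mono divide_strict_right_mono) auto
    then show ?thesis by (simp add: s2)
  qed
  have inc1: "(\<lambda>n. F n (of_real (T / 2)) - F n (of_real 0)) \<longlonglongrightarrow> f\<^sub>1 (of_real (T / 2)) - f\<^sub>1 (of_real 0)"
  proof (rule increments_tendsto[where h = "\<lambda>n x. exp (u n (of_real x))" and k = "\<lambda>x. exp (g\<^sub>1 (of_real x))" and M = M])
    fix x assume x: "0 < x" "x < T / 2"
    then have "(\<lambda>n. (smoothstep ^^ n) (of_real (x / T))) \<longlonglongrightarrow> 0"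
      using T0 by (intro smoothstep_iterate_tendsto_0) (auto simp: field_simps)
    moreover have "(\<lambda>n. (smoothstep ^^ n) (of_real ((x / T)\<^sup>2))) \<longlonglongrightarrow> 0"
      using x Ts sq_less[of x] by (intro smoothstep_iterate_tendsto_0) auto
    ultimately show "(\<lambda>n. exp (u n (of_real x))) \<longlonglongrightarrow> exp (g\<^sub>1 (of_real x))"
      using u_lim[of x 0 0] by simp
  qed (use T0 M F f\<^sub>1 real_S in auto)
  have inc2: "(\<lambda>n. F n (of_real s) - F n (of_real (T / 2))) \<longlonglongrightarrow> exp c * of_real s - exp c * of_real (T / 2)"
  proof (rule increments_tendsto[where h = "\<lambda>n x. exp (u n (of_real x))" and k = "\<lambda>x. exp c" and M = M and f = "\<lambda>z. exp c * z"])
    fix x assume x: "T / 2 < x" "x < s"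
    then have "(\<lambda>n. (smoothstep ^^ n) (of_real (x / T))) \<longlonglongrightarrow> 1"
      using T0 sT by (intro smoothstep_iterate_tendsto_1) (auto simp: field_simps)
    moreover have "(\<lambda>n. (smoothstep ^^ n) (of_real ((x / T)\<^sup>2))) \<longlonglongrightarrow> 0"
      using x T0 sq_less[of x] by (intro smoothstep_iterate_tendsto_0) auto
    ultimately show "(\<lambda>n. exp (u n (of_real x))) \<longlonglongrightarrow> exp c"
      using u_lim[of x 1 0] by simp
  next
    fix x show "((\<lambda>z. exp c * z) has_field_derivative exp c) (at (of_real x))"
      by (auto intro!: derivative_eq_intros)
  qed (use T0 Ts sT M F real_S in auto)
  have inc3: "(\<lambda>n. F n (of_real T) - F n (of_real s)) \<longlonglongrightarrow> f\<^sub>2 (of_real T - of_real T) - f\<^sub>2 (of_real s - of_real T)"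
  proof (rule increments_tendsto[where h = "\<lambda>n x. exp (u n (of_real x))" and k = "\<lambda>x. exp (g\<^sub>2 (of_real x - of_real T))" and M = M and f = "\<lambda>z. f\<^sub>2 (z - of_real T)"])
    fix x assume x: "s < x" "x < T"
    then have "(\<lambda>n. (smoothstep ^^ n) (of_real (x / T))) \<longlonglongrightarrow> 1"
      using T0 Ts by (intro smoothstep_iterate_tendsto_1) (auto simp: field_simps)
    moreover have "(\<lambda>n. (smoothstep ^^ n) (of_real ((x / T)\<^sup>2))) \<longlonglongrightarrow> 1"
      using x T0 Ts sq_greater[of x] by (intro smoothstep_iterate_tendsto_1) (auto simp: power_le_one)
    ultimately show "(\<lambda>n. exp (u n (of_real x))) \<longlonglongrightarrow> exp (g\<^sub>2 (of_real x - of_real T))"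
      using u_lim[of x 1 1] by simp
  next
    fix x :: real
    have mem: "of_real x - of_real T \<in> S" using minus_S real_S by blast
    have "((\<lambda>z::complex. z - of_real T) has_field_derivative 1) (at (of_real x))"
      by (auto intro!: derivative_eq_intros)
    from DERIV_chain2[OF f\<^sub>2[OF mem] this] show "((\<lambda>z. f\<^sub>2 (z - of_real T)) has_field_derivative exp (g\<^sub>2 (of_real x - of_real T))) (at (of_real x))"
      by simp
  qed (use T0 Ts sT M F real_S in auto)
  \<comment> \<open>The three increments telescope to \<open>F n T\<close>, and their limits to \<open>f\<^sub>2 0 + err\<close> by the choice of \<open>c\<close>.\<close>
  have "(\<lambda>n. f\<^sub>1 0 + (F n (of_real (T / 2)) - F n (of_real 0)) + (F n (of_real s) - F n (of_real (T / 2)))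
      + (F n (of_real T) - F n (of_real s))) \<longlonglongrightarrow>
      f\<^sub>1 0 + (f\<^sub>1 (of_real (T / 2)) - f\<^sub>1 (of_real 0)) + (exp c * of_real s - exp c * of_real (T / 2))
      + (f\<^sub>2 (of_real T - of_real T) - f\<^sub>2 (of_real s - of_real T))"
    by (intro tendsto_add tendsto_const inc1 inc2 inc3)
  moreover have "f\<^sub>1 0 + (F n (of_real (T / 2)) - F n (of_real 0)) + (F n (of_real s) - F n (of_real (T / 2)))
      + (F n (of_real T) - F n (of_real s)) = F n (of_real T)" for n
    using F0[of n] by simp
  moreover have "f\<^sub>1 0 + (f\<^sub>1 (of_real (T / 2)) - f\<^sub>1 (of_real 0)) + (exp c * of_real s - exp c * of_real (T / 2))
      + (f\<^sub>2 (of_real T - of_real T) - f\<^sub>2 (of_real s - of_real T)) = f\<^sub>2 0 + err"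
    by (simp add: err_def m_def d_def algebra_simps)
  ultimately have F_T: "(\<lambda>n. F n (of_real T)) \<longlonglongrightarrow> f\<^sub>2 0 + err"
    by (simp only:)

  have lim_f\<^sub>2: "uniform_limit L (\<lambda>n z. F n (z + of_real T)) (\<lambda>z. f\<^sub>2 z + err) sequentially"
  proof (rule uniform_limit_of_derivatives[where a = 0])
    have "uniform_limit L (\<lambda>n z. \<alpha> n (z + of_real T)) (\<lambda>_. 1) sequentially"
    proof (rule uniform_limit_geometric)
      fix n z assume "z \<in> L"
      moreover have "(z + of_real T) / of_real T - 1 = z / of_real T" using T0 by (simp add: field_simps)
      ultimately have "norm ((z + of_real T) / of_real T - 1) \<le> 1/8" using small[of z] by simp
      then show "norm (\<alpha> n (z + of_real T) - 1) \<le> (1/2) ^ n"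
        unfolding \<alpha>_def by (rule norm_smoothstep_iterate_near_1)
    qed
    moreover have "uniform_limit L (\<lambda>n z. \<beta> n (z + of_real T)) (\<lambda>_. 1) sequentially"
    proof (rule uniform_limit_geometric)
      fix n z assume z: "z \<in> L"
      define w where "w = z / of_real T"
      have w: "norm w \<le> 1/20" using small[OF z] by (simp add: w_def)
      have "(z + of_real T) / of_real T = 1 + w" using T0 by (simp add: w_def field_simps)
      then have "((z + of_real T) / of_real T)\<^sup>2 - 1 = w * (2 + w)"
        by (simp add: power2_eq_square algebra_simps)
      moreover have "norm (2 + w) \<le> 2 + 1/20" using norm_triangle_ineq[of 2 w] w by simp
      then have "norm w * norm (2 + w) \<le> (1/20) * (2 + 1/20)" using w by (intro mult_mono) auto
      ultimately have "norm (((z + of_real T) / of_real T)\<^sup>2 - 1) \<le> 1/8"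
        by (simp add: norm_mult)
      then show "norm (\<beta> n (z + of_real T) - 1) \<le> (1/2) ^ n"
        unfolding \<beta>_def by (rule norm_smoothstep_iterate_near_1)
    qed
    ultimately have "uniform_limit L (\<lambda>n z. u n (z + of_real T)) g\<^sub>2 sequentially"
      using uniform_limit_blend[where K = L and F = sequentially and \<alpha> = "\<lambda>n z. \<alpha> n (z + of_real T)" and a = 1
          and \<beta> = "\<lambda>n z. \<beta> n (z + of_real T)" and b = 1
          and p = "\<lambda>z. g\<^sub>1 (z + of_real T)" and q = g\<^sub>2 and c = c]
        bd[OF g\<^sub>1 LS L(1), of T] bd[OF g\<^sub>2 LS L(1), of 0]
      by (simp add: u_def[abs_def])
    moreover have "bounded (g\<^sub>2 ` L)" using bd[OF g\<^sub>2 LS L(1), of 0] by simp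
    ultimately show "uniform_limit L (\<lambda>n z. exp (u n (z + of_real T))) (\<lambda>z. exp (g\<^sub>2 z)) sequentially"
      by (rule uniform_limit_exp)
  next
    fix n z assume "z \<in> L"
    then have "z + of_real T \<in> S" using LS trans by blast
    then show "((\<lambda>z. F n (z + of_real T)) has_field_derivative exp (u n (z + of_real T))) (at z)"
      using F DERIV_shift by blast
  next
    fix z assume "z \<in> L"
    then show "((\<lambda>z. f\<^sub>2 z + err) has_field_derivative exp (g\<^sub>2 z)) (at z)"
      using f\<^sub>2[of z] LS by (auto intro!: derivative_eq_intros)
  qed (use L LS F_T in \<open>auto intro: compact_imp_bounded\<close>)

  have "\<forall>\<^sub>F n in sequentially. \<forall>z\<in>L. dist (F n z) (f\<^sub>1 z) < e"
    using lim_f\<^sub>1 e by (rule uniform_limitD)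
  moreover have "\<forall>\<^sub>F n in sequentially. \<forall>z\<in>L. dist (F n (z + of_real T)) (f\<^sub>2 z + err) < e / 2"
    using uniform_limitD[OF lim_f\<^sub>2, of "e / 2"] e by simp
  ultimately have "\<forall>\<^sub>F n in sequentially. (\<forall>z\<in>L. dist (F n z) (f\<^sub>1 z) < e) \<and>
      (\<forall>z\<in>L. dist (F n (z + of_real T)) (f\<^sub>2 z + err) < e / 2)"
    by (rule eventually_conj)
  then obtain n where n: "\<And>z. z \<in> L \<Longrightarrow> dist (F n z) (f\<^sub>1 z) < e"
    "\<And>z. z \<in> L \<Longrightarrow> dist (F n (z + of_real T)) (f\<^sub>2 z + err) < e / 2"
    using eventually_happens' sequentially_bot by blast
  show ?thesis
  proof (rule that[of "F n" T])
    show "noncritical_on S (F n)" by (rule Fnc)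
    fix z assume "z \<in> K"
    then have z: "z \<in> L" using L by blast
    show "dist (F n z) (f\<^sub>1 z) < e" using n(1)[OF z] .
    have "dist (F n (z + of_real T)) (f\<^sub>2 z) \<le> dist (F n (z + of_real T)) (f\<^sub>2 z + err) + norm err"
      using dist_triangle[of "F n (z + of_real T)" "f\<^sub>2 z" "f\<^sub>2 z + err"] by (simp add: dist_norm)
    then show "dist (F n (z + of_real T)) (f\<^sub>2 z) < e"
      using n(2)[OF z] c by (simp add: err_def)
  qed
qed

lemma noncritical_on_id: "noncritical_on S (\<lambda>z. z)"
  by (simp add: noncritical_on_def)

section \<open>Universality under translations\<close>

definition compact_exhaustion :: "complex set \<Rightarrow> (nat \<Rightarrow> complex set) \<Rightarrow> bool" where
  "compact_exhaustion S C \<longleftrightarrow> (\<forall>n. compact (C n) \<and> C n \<subseteq> S) \<and>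
     (\<forall>K. compact K \<and> K \<subseteq> S \<longrightarrow> (\<exists>N. \<forall>n\<ge>N. K \<subseteq> C n))"

lemma compact_exhaustion_exists:
  assumes "open S"
  obtains C where "compact_exhaustion S C"
proof (rule open_Union_compact_subsets[OF assms])
  fix C :: "nat \<Rightarrow> complex set"
  assume "\<And>n. compact (C n)" "\<And>n. C n \<subseteq> S"
    "\<And>K. \<lbrakk>compact K; K \<subseteq> S\<rbrakk> \<Longrightarrow> \<exists>N. \<forall>n\<ge>N. K \<subseteq> C n"
  then have "compact_exhaustion S C" by (simp add: compact_exhaustion_def)
  then show thesis by (rule that)
qed

lemma compact_exhaustionD:
  assumes "compact_exhaustion S C"
  shows "compact (C n)" "C n \<subseteq> S"
    "compact K \<Longrightarrow> K \<subseteq> S \<Longrightarrow> \<exists>N. \<forall>n\<ge>N. K \<subseteq> C n"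
  using assms by (auto simp: compact_exhaustion_def)

text \<open>
  Every member of a countable dense family has to be a target infinitely often, since in the limit
  process below only the targets with large index are met with small error. Reading the index as an
  encoded pair \<open>(i, j)\<close> and using member \<open>i\<close> achieves this.
\<close>
lemma noncritical_dense_sequence:
  assumes S: "open S"
  obtains h :: "nat \<Rightarrow> complex \<Rightarrow> complex"
  where "\<And>n. noncritical_on S (h n)"
    "\<And>f K e N. noncritical_on S f \<Longrightarrow> compact K \<Longrightarrow> K \<subseteq> S \<Longrightarrow> e > 0 \<Longrightarrow>
       \<exists>n\<ge>N. \<forall>z\<in>K. dist (h n z) (f z) < e"
proof -
  obtain C where "compact_exhaustion S C" by (rule compact_exhaustion_exists[OF S])
  note C = compact_exhaustionD[OF this]
  let ?X = "Collect (noncritical_on S)"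
  have "\<exists>D. countable D \<and> D \<subseteq> ?X \<and> (\<forall>f\<in>?X. \<forall>e>0. \<exists>g\<in>D. \<forall>z\<in>C n. dist (g z) (f z) < e)" for n
  proof (rule separable_continuous_functions_on_compact[OF C(1)[of n], of ?X])
    fix f assume "f \<in> ?X"
    then show "continuous_on (C n) f"
      using C(2) holomorphic_on_imp_continuous_on continuous_on_subset
      unfolding noncritical_on_def by blast
  qed blast
  then obtain D where D: "\<And>n. countable (D n)" "\<And>n. D n \<subseteq> ?X"
    "\<And>n f e. noncritical_on S f \<Longrightarrow> e > 0 \<Longrightarrow> \<exists>g\<in>D n. \<forall>z\<in>C n. dist (g z) (f z) < e"
    by (metis mem_Collect_eq)
  define E where "E = (\<Union>n. D n)"
  have cE: "countable E" unfolding E_def using D(1) by blast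
  have EX: "E \<subseteq> ?X" unfolding E_def using D(2) by blast
  have "\<exists>g\<in>D 0. \<forall>z\<in>C 0. dist (g z) z < 1"
    using D(3)[OF noncritical_on_id, of 1 0] by simp
  then have nE: "E \<noteq> {}" unfolding E_def by blast
  define h where "h n = from_nat_into E (fst (prod_decode n))" for n
  show ?thesis
  proof (rule that[of h])
    show "noncritical_on S (h n)" for n
      using from_nat_into[OF nE] EX unfolding h_def by blast
    fix f K and e :: real and N assume f: "noncritical_on S f" and K: "compact K" "K \<subseteq> S" and e: "e > 0"
    obtain j where j: "K \<subseteq> C j" using C(3)[OF K] by blast
    obtain g where g: "g \<in> D j" "\<forall>z\<in>C j. dist (g z) (f z) < e" using D(3)[OF f e] by blast
    have "g \<in> E" using g(1) unfolding E_def by blast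
    then obtain i where i: "from_nat_into E i = g" using from_nat_into_surj[OF cE] by blast
    show "\<exists>n\<ge>N. \<forall>z\<in>K. dist (h n z) (f z) < e"
    proof (intro exI conjI)
      show "N \<le> prod_encode (i, N)" by (rule le_prod_encode_2)
      show "\<forall>z\<in>K. dist (h (prod_encode (i, N)) z) (f z) < e"
        using g(2) j i by (auto simp: h_def)
    qed
  qed
qed

text \<open>
  The sets on which consecutive functions are compared may grow, so that the later sets can contain
  translates chosen during the construction.
\<close>
lemma geometric_steps_limit:
  fixes G :: "nat \<Rightarrow> 'a \<Rightarrow> 'b::complete_space"
  assumes mono: "\<And>n. L n \<subseteq> L (Suc n)"
    and step: "\<And>n z. z \<in> L n \<Longrightarrow> dist (G (Suc n) z) (G n z) < (1/2)^n"
  obtains F where "\<And>n z. z \<in> L n \<Longrightarrow> dist (F z) (G n z) \<le> 2 * (1/2)^n"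
    "\<And>n. uniform_limit (L n) G F sequentially"
proof -
  have L_le: "L n \<subseteq> L m" if "n \<le> m" for n m using mono that by (rule lift_Suc_mono_le)
  have near: "dist (G (n + k) z) (G n z) \<le> 2 * (1/2)^n - 2 * (1/2)^(n + k)" if z: "z \<in> L n" for n k z
  proof (induction k)
    case (Suc k)
    have "z \<in> L (n + k)" using L_le[of n "n + k"] z by auto
    then have "dist (G (Suc (n + k)) z) (G (n + k) z) < (1/2)^(n + k)" by (rule step)
    moreover have "dist (G (n + Suc k) z) (G n z) \<le> dist (G (Suc (n + k)) z) (G (n + k) z) + dist (G (n + k) z) (G n z)"
      by (simp add: dist_triangle)
    ultimately show ?case using Suc by simp
  qed simp
  have near': "dist (G m z) (G n z) \<le> 2 * (1/2)^n" if "z \<in> L n" "n \<le> m" for n m z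
  proof -
    have "dist (G (n + (m - n)) z) (G n z) \<le> 2 * (1/2)^n - 2 * (1/2)^(n + (m - n))"
      using that(1) by (rule near)
    also have "\<dots> \<le> 2 * (1/2)^n" by simp
    finally show ?thesis using that(2) by simp
  qed
  have pow: "\<exists>n\<ge>N. 2 * (1/2)^n < e" if "e > 0" for e :: real and N :: nat
  proof -
    have "(\<lambda>n. 2 * (1/2::real)^n) \<longlonglongrightarrow> 2 * 0" by (intro tendsto_mult tendsto_const LIMSEQ_power_zero) simp
    then have "\<forall>\<^sub>F n in sequentially. 2 * (1/2::real)^n < e" using that by (intro order_tendstoD(2)) auto
    then show ?thesis unfolding eventually_sequentially by (meson nle_le)
  qed
  define F where "F z = lim (\<lambda>n. G n z)" for z
  have conv: "(\<lambda>n. G n z) \<longlonglongrightarrow> F z" if z: "z \<in> L N" for z N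
  proof -
    have "Cauchy (\<lambda>n. G n z)"
    proof (rule metric_CauchyI)
      fix e :: real assume "e > 0"
      then obtain n where n: "n \<ge> N" "2 * (1/2)^n < e / 2" using pow[of "e / 2" N] by auto
      have zn: "z \<in> L n" using L_le[OF n(1)] z by blast
      have "dist (G k z) (G m z) < e" if "k \<ge> n" "m \<ge> n" for k m
        using near'[OF zn that(1)] near'[OF zn that(2)] n(2)
          dist_triangle2[of "G k z" "G m z" "G n z"] by linarith
      then show "\<exists>M. \<forall>m\<ge>M. \<forall>n\<ge>M. dist (G m z) (G n z) < e" by blast
    qed
    then show ?thesis unfolding F_def by (simp add: Cauchy_convergent_iff convergent_LIMSEQ_iff)
  qed
  have close: "dist (F z) (G n z) \<le> 2 * (1/2)^n" if z: "z \<in> L n" for n z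
  proof (rule LIMSEQ_le_const2)
    show "(\<lambda>m. dist (G m z) (G n z)) \<longlonglongrightarrow> dist (F z) (G n z)"
      by (intro tendsto_dist conv[OF z] tendsto_const)
    show "\<exists>N. \<forall>m\<ge>N. dist (G m z) (G n z) \<le> 2 * (1/2)^n" using near'[OF z] by blast
  qed
  have "uniform_limit (L N) G F sequentially" for N
  proof (rule uniform_limitI)
    fix e :: real assume "e > 0"
    then obtain n where n: "n \<ge> N" "2 * (1/2)^n < e" using pow by blast
    have "dist (G m z) (F z) < e" if m: "m \<ge> n" and z: "z \<in> L N" for m z
    proof -
      have "z \<in> L m" using L_le[of N m] n m z by auto
      then have "dist (F z) (G m z) \<le> 2 * (1/2)^m" by (rule close)
      also have "\<dots> \<le> 2 * (1/2)^n" using m by (intro mult_left_mono power_decreasing) auto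
      finally show ?thesis using n by (simp add: dist_commute)
    qed
    then show "\<forall>\<^sub>F n in sequentially. \<forall>z\<in>L N. dist (G n z) (F z) < e"
      unfolding eventually_sequentially by blast
  qed
  with close show ?thesis by (rule that)
qed

text \<open>
  An inductive construction. Stage \<open>n\<close> perturbs the current function by less than \<open>(1/2)^n\<close>
  on a compact set \<open>L n\<close> and makes some translate of it close to the \<open>n\<close>-th target on the \<open>n\<close>-th
  set of an exhaustion. The translated set is then added to \<open>L\<close>, so that all later perturbations
  together keep the approximation. The limit cannot be constant, since its translates approximate the
  identity, and therefore it has no critical points by Hurwitz's theorem.
\<close>
lemma universal_noncritical_translates:
  assumes S: "open S" "convex S" "0 \<in> S"
    and trans: "\<And>z t. z \<in> S \<Longrightarrow> z + of_real t \<in> S"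
  obtains F where "noncritical_on S F"
    "\<And>f K e. noncritical_on S f \<Longrightarrow> compact K \<Longrightarrow> K \<subseteq> S \<Longrightarrow> e > 0 \<Longrightarrow>
       \<exists>t. \<forall>z\<in>K. dist (F (z + of_real t)) (f z) < e"
proof -
  obtain h :: "nat \<Rightarrow> complex \<Rightarrow> complex" where h: "\<And>n. noncritical_on S (h n)"
    and dense: "\<And>f K e N. noncritical_on S f \<Longrightarrow> compact K \<Longrightarrow> K \<subseteq> S \<Longrightarrow> e > 0 \<Longrightarrow>
       \<exists>n\<ge>N. \<forall>z\<in>K. dist (h n z) (f z) < e"
  proof (rule noncritical_dense_sequence[OF S(1)])
    fix h :: "nat \<Rightarrow> complex \<Rightarrow> complex"
    assume 1: "\<And>n. noncritical_on S (h n)"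
      and 2: "\<And>f K e N. noncritical_on S f \<Longrightarrow> compact K \<Longrightarrow> K \<subseteq> S \<Longrightarrow> e > 0 \<Longrightarrow>
       \<exists>n\<ge>N. \<forall>z\<in>K. dist (h n z) (f z) < e"
    show thesis by (rule that[of h]) (rule 1, rule 2)
  qed
  obtain C where "compact_exhaustion S C" by (rule compact_exhaustion_exists[OF S(1)])
  note C = compact_exhaustionD[OF this]
  define P where "P n X \<longleftrightarrow> noncritical_on S (fst X) \<and> compact (snd X) \<and> snd X \<subseteq> S \<and> C n \<subseteq> snd X"
    for n and X :: "(complex \<Rightarrow> complex) \<times> complex set"
  define Q where "Q n X Y \<longleftrightarrow> snd X \<subseteq> snd Y \<and> (\<forall>z\<in>snd X. dist (fst Y z) (fst X z) < (1/2)^n) \<and>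
      (\<exists>T. \<forall>z\<in>C n. z + of_real T \<in> snd Y \<and> dist (fst Y (z + of_real T)) (h n z) < (1/2)^n)"
    for n and X Y :: "(complex \<Rightarrow> complex) \<times> complex set"
  have "\<exists>X. \<forall>n. P n (X n) \<and> Q n (X n) (X (Suc n))"
  proof (rule dependent_nat_choice)
    show "\<exists>X. P 0 X"
    proof
      show "P 0 (\<lambda>z. z, C 0)" by (simp add: P_def noncritical_on_id C)
    qed
    fix X n assume X: "P n X"
    obtain G L where GL: "X = (G, L)" by fastforce
    have G: "noncritical_on S G" and L: "compact L" "L \<subseteq> S" "C n \<subseteq> L" using X by (auto simp: P_def GL)
    obtain T G' where G': "noncritical_on S G'" "\<And>z. z \<in> L \<Longrightarrow> dist (G' z) (G z) < (1/2)^n"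
      "\<And>z. z \<in> L \<Longrightarrow> dist (G' (z + of_real T)) (h n z) < (1/2)^n"
      by (rule noncritical_blend_translates[OF S trans G h[of n] L(1,2), of "(1/2)^n"]) auto
    define L' where "L' = L \<union> C (Suc n) \<union> (\<lambda>z. z + of_real T) ` C n"
    have "compact L'" unfolding L'_def using L C
      by (intro compact_Un compact_continuous_image continuous_intros) auto
    moreover have "L' \<subseteq> S" unfolding L'_def using L C(2) trans by blast
    moreover have "C (Suc n) \<subseteq> L'" unfolding L'_def by blast
    ultimately have "P (Suc n) (G', L')" using G'(1) by (simp add: P_def)
    moreover have "Q n X (G', L')"
      unfolding Q_def GL using G' L(3) by (auto simp: L'_def)
    ultimately show "\<exists>Y. P (Suc n) Y \<and> Q n X Y" by blast
  qed
  then obtain X where X: "\<And>n. P n (X n)" "\<And>n. Q n (X n) (X (Suc n))" by blast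
  define G where "G n = fst (X n)" for n
  define L where "L n = snd (X n)" for n
  have G: "\<And>n. noncritical_on S (G n)" and L: "\<And>n. L n \<subseteq> S" "\<And>n. C n \<subseteq> L n"
    using X(1) by (auto simp: P_def G_def L_def)
  have L_Suc: "\<And>n. L n \<subseteq> L (Suc n)" and step: "\<And>n z. z \<in> L n \<Longrightarrow> dist (G (Suc n) z) (G n z) < (1/2)^n"
    and hit: "\<And>n. \<exists>T. \<forall>z\<in>C n. z + of_real T \<in> L (Suc n) \<and> dist (G (Suc n) (z + of_real T)) (h n z) < (1/2)^n"
    using X(2) by (auto simp: Q_def G_def L_def)
  obtain F where close: "\<And>n z. z \<in> L n \<Longrightarrow> dist (F z) (G n z) \<le> 2 * (1/2)^n"
    and ulL: "\<And>n. uniform_limit (L n) G F sequentially"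
    using geometric_steps_limit[of L G] L_Suc step by blast
  have ul: "uniform_limit K G F sequentially" if "compact K" "K \<subseteq> S" for K
  proof -
    obtain N where "K \<subseteq> C N" using C(3)[OF \<open>compact K\<close> \<open>K \<subseteq> S\<close>] by blast
    then have "K \<subseteq> L N" using L(2) by blast
    then show ?thesis using ulL by (rule uniform_limit_on_subset[rotated])
  qed
  have F_hol: "F holomorphic_on S"
  proof (rule holomorphic_uniform_sequence[OF S(1), of G])
    show "G n holomorphic_on S" for n using G by (simp add: noncritical_on_def)
    fix z assume "z \<in> S"
    then obtain r where "r > 0" "cball z r \<subseteq> S" using S(1) open_contains_cball by blast
    then show "\<exists>d>0. cball z d \<subseteq> S \<and> uniform_limit (cball z d) G F sequentially"
      using ul[OF compact_cball] by blast
  qed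
  have univ: "\<exists>t. \<forall>z\<in>K. dist (F (z + of_real t)) (f z) < e"
    if f: "noncritical_on S f" and K: "compact K" "K \<subseteq> S" and e: "e > 0" for f K and e :: real
  proof -
    obtain N\<^sub>1 where N\<^sub>1: "\<forall>n\<ge>N\<^sub>1. K \<subseteq> C n" using C(3)[OF K] by blast
    obtain N\<^sub>2 where N\<^sub>2: "(1/2::real) ^ N\<^sub>2 < e / 4"
      using real_arch_pow_inv[of "e / 4" "1/2"] e by auto
    obtain n where n: "n \<ge> max N\<^sub>1 N\<^sub>2" "\<forall>z\<in>K. dist (h n z) (f z) < e / 2"
      using dense[OF f K, of "e / 2" "max N\<^sub>1 N\<^sub>2"] e by auto
    have KC: "K \<subseteq> C n" using N\<^sub>1 n by simp
    have "(1/2::real) ^ n \<le> (1/2) ^ N\<^sub>2" using n by (intro power_decreasing) auto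
    then have small: "(1/2::real) ^ n < e / 4" using N\<^sub>2 by (rule order_le_less_trans)
    obtain T where T: "\<forall>z\<in>C n. z + of_real T \<in> L (Suc n) \<and> dist (G (Suc n) (z + of_real T)) (h n z) < (1/2)^n"
      using hit by blast
    have "dist (F (z + of_real T)) (f z) < e" if z: "z \<in> K" for z
    proof -
      have zT: "z + of_real T \<in> L (Suc n)" "dist (G (Suc n) (z + of_real T)) (h n z) < (1/2)^n"
        using T KC z by auto
      have "dist (F (z + of_real T)) (G (Suc n) (z + of_real T)) \<le> (1/2)^n"
        using close[OF zT(1)] by simp
      moreover have "dist (h n z) (f z) < e / 2" using n z by blast
      ultimately show ?thesis
        using zT(2) small dist_triangle[of "F (z + of_real T)" "f z" "h n z"]
          dist_triangle[of "F (z + of_real T)" "h n z" "G (Suc n) (z + of_real T)"] by linarith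
    qed
    then show ?thesis by blast
  qed
  have nonconst: "\<not> F constant_on S"
  proof
    assume "F constant_on S"
    then obtain c where c: "\<And>z. z \<in> S \<Longrightarrow> F z = c" unfolding constant_on_def by blast
    have S1: "1 \<in> S" using trans[OF S(3), of 1] by simp
    obtain t where t: "\<forall>z\<in>{0, 1}. dist (F (z + of_real t)) z < 1/2"
      using univ[OF noncritical_on_id, of "{0, 1}" "1/2"] S(3) S1 by auto
    have "F (0 + of_real t) = c" "F (1 + of_real t) = c" using c trans S(3) S1 by blast+
    then have "dist c 0 < 1/2" "dist c 1 < 1/2" using t by auto
    then have "dist (0::complex) 1 < 1"
      using dist_triangle3[of 0 1 c] by simp
    then show False by simp
  qed
  have "deriv F z \<noteq> 0" if "z \<in> S" for z
  proof (rule Hurwitz_deriv_nonzero[OF S(1) convex_connected[OF S(2)], where F = G])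
    show "uniform_limit K G F sequentially" if "compact K" "K \<subseteq> S" for K using that by (rule ul)
  qed (use G F_hol nonconst that in \<open>auto simp: noncritical_on_def\<close>)
  then have "noncritical_on S F" using F_hol by (simp add: noncritical_on_def)
  then show ?thesis using univ by (rule that)
qed

section \<open>Translation invariant models of simply connected domains\<close>

text \<open>
  The Cayley transform maps the unit disc onto the right half plane because points of the half plane
  are those closer to \<open>1\<close> than to \<open>-1\<close>.
\<close>
lemma norm_diff_less_sum_iff_Re_pos: "norm (w - 1) < norm (w + 1) \<longleftrightarrow> 0 < Re w"
proof -
  have "norm (w - 1) < norm (w + 1) \<longleftrightarrow> (norm (w - 1))\<^sup>2 < (norm (w + 1))\<^sup>2"
    by (meson norm_ge_zero pos2 power2_less_imp_less power_strict_mono)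
  also have "\<dots> \<longleftrightarrow> 0 < Re w" unfolding cmod_power2 by (simp add: power2_eq_square algebra_simps)
  finally show ?thesis .
qed

text \<open>
  The disc becomes the right half plane by \<open>(1 + z) / (1 - z)\<close>, and the half plane becomes the strip
  by the principal logarithm. The strip is preferred to the disc because some of its automorphisms
  are translations: composing with them merely translates the derivative, so no factor coming from
  the automorphism enters the approximation.
\<close>
lemma disc_biholomorphic_strip:
  defines "S \<equiv> {z. \<bar>Im z\<bar> < pi / 2}"
  obtains a b where "a holomorphic_on ball 0 1" "b holomorphic_on S"
    "\<And>z. z \<in> ball 0 1 \<Longrightarrow> a z \<in> S \<and> b (a z) = z"
    "\<And>w. w \<in> S \<Longrightarrow> b w \<in> ball 0 1 \<and> a (b w) = w"
proof -
  define c where "c z = (1 + z) / (1 - z)" for z :: complex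
  define b where "b w = (exp w - 1) / (exp w + 1)" for w :: complex
  have ne: "1 - z \<noteq> 0" if "z \<in> ball 0 1" for z :: complex
    using that by auto
  have c: "0 < Re (c z)" "(c z - 1) / (c z + 1) = z" if z: "z \<in> ball 0 1" for z
  proof -
    have e: "c z + 1 = 2 / (1 - z)" "c z - 1 = z * (2 / (1 - z))"
      using ne[OF z] by (simp_all add: c_def field_simps)
    then show "(c z - 1) / (c z + 1) = z" using ne[OF z] by simp
    have "norm z * norm (2 / (1 - z)) < 1 * norm (2 / (1 - z))"
      using z ne[OF z] by (intro mult_strict_right_mono) auto
    then have "norm (c z - 1) < norm (c z + 1)" by (simp only: e norm_mult mult_1)
    then show "0 < Re (c z)" by (simp only: norm_diff_less_sum_iff_Re_pos)
  qed
  have Re_exp_pos: "0 < Re (exp w)" if "w \<in> S" for w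
    using that cos_gt_zero_pi[of "Im w"] by (auto simp: S_def Re_exp abs_less_iff)
  have b: "norm (b w) < 1" "c (b w) = exp w" "exp w + 1 \<noteq> 0" if w: "w \<in> S" for w
  proof -
    have lt: "norm (exp w - 1) < norm (exp w + 1)"
      using Re_exp_pos[OF w] by (simp only: norm_diff_less_sum_iff_Re_pos)
    then show ne0: "exp w + 1 \<noteq> 0" by auto
    show "norm (b w) < 1" using lt by (simp add: b_def norm_divide divide_simps)
    have "1 + b w = 2 * exp w / (exp w + 1)" "1 - b w = 2 / (exp w + 1)"
      using ne0 by (simp_all add: b_def field_simps)
    then show "c (b w) = exp w" using ne0 by (simp add: c_def)
  qed
  show ?thesis
  proof (rule that[of "\<lambda>z. Ln (c z)" b])
    have "c holomorphic_on ball 0 1" unfolding c_def using ne by (intro holomorphic_intros) auto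
    moreover have "c z \<notin> \<real>\<^sub>\<le>\<^sub>0" if "z \<in> ball 0 1" for z
      using c(1)[OF that] by (simp add: complex_nonpos_Reals_iff)
    ultimately show "(\<lambda>z. Ln (c z)) holomorphic_on ball 0 1" by (intro holomorphic_on_Ln') auto
    show "b holomorphic_on S" unfolding b_def using b(3) by (intro holomorphic_intros) auto
    show "Ln (c z) \<in> S \<and> b (Ln (c z)) = z" if z: "z \<in> ball 0 1" for z
    proof
      have nz: "c z \<noteq> 0" using c(1)[OF z] by auto
      then show "Ln (c z) \<in> S" using c(1)[OF z] Re_Ln_pos_lt by (simp add: S_def)
      show "b (Ln (c z)) = z" using nz c(2)[OF z] by (simp add: b_def)
    qed
    show "b w \<in> ball 0 1 \<and> Ln (c (b w)) = w" if w: "w \<in> S" for w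
    proof
      show "b w \<in> ball 0 1" using b(1)[OF w] by simp
      have "- pi < Im w" "Im w \<le> pi" using w pi_gt_zero unfolding S_def by auto
      then show "Ln (c (b w)) = w" using b(2)[OF w] by simp
    qed
  qed
qed

lemma simply_connected_biholomorphic_translation_invariant:
  assumes "open \<Omega>" "\<Omega> \<noteq> {}" "simply_connected \<Omega>"
  obtains S p q where "open S" "convex S" "0 \<in> S" "\<And>z t. z \<in> S \<Longrightarrow> z + of_real t \<in> S"
    "p holomorphic_on \<Omega>" "q holomorphic_on S"
    "\<And>z. z \<in> \<Omega> \<Longrightarrow> p z \<in> S \<and> q (p z) = z" "\<And>w. w \<in> S \<Longrightarrow> q w \<in> \<Omega> \<and> p (q w) = w"
proof (cases "\<Omega> = UNIV")
  case True
  then show ?thesis using that[of UNIV "\<lambda>z. z" "\<lambda>z. z"] by simp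
next
  case False
  then obtain f g where fg: "f holomorphic_on \<Omega>" "g holomorphic_on ball 0 1"
    "\<forall>z\<in>\<Omega>. f z \<in> ball 0 1 \<and> g (f z) = z" "\<forall>z\<in>ball 0 1. g z \<in> \<Omega> \<and> f (g z) = z"
    using assms Riemann_mapping_theorem[of \<Omega>] by blast
  define S where "S = {z. \<bar>Im z\<bar> < pi / 2}"
  obtain a b where ab: "a holomorphic_on ball 0 1" "b holomorphic_on S"
    "\<And>z. z \<in> ball 0 1 \<Longrightarrow> a z \<in> S \<and> b (a z) = z"
    "\<And>w. w \<in> S \<Longrightarrow> b w \<in> ball 0 1 \<and> a (b w) = w"
    using disc_biholomorphic_strip unfolding S_def by blast
  have S_eq: "S = {z. Im z < pi / 2} \<inter> {z. Im z > - (pi / 2)}" unfolding S_def by auto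
  show ?thesis
  proof (rule that[of S "a \<circ> f" "g \<circ> b"])
    show "open S" unfolding S_eq by (intro open_Int open_halfspace_Im_lt open_halfspace_Im_gt)
    show "convex S" unfolding S_eq by (intro convex_Int convex_halfspace_Im_lt convex_halfspace_Im_gt)
    show "0 \<in> S" by (simp add: S_def)
    show "z + of_real t \<in> S" if "z \<in> S" for z t using that by (simp add: S_def)
    show "(a \<circ> f) holomorphic_on \<Omega>" using fg ab by (intro holomorphic_on_compose_gen[of f _ a "ball 0 1"]) auto
    show "(g \<circ> b) holomorphic_on S" using fg ab by (intro holomorphic_on_compose_gen[of b _ g "ball 0 1"]) auto
  qed (use fg ab in auto)
qed

lemma noncritical_on_compose:
  assumes "open \<Omega>" "open S" and p: "p holomorphic_on \<Omega>" "inj_on p \<Omega>" "p ` \<Omega> \<subseteq> S"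
    and F: "noncritical_on S F"
  shows "noncritical_on \<Omega> (\<lambda>z. F (p z))"
proof -
  have holF: "F holomorphic_on S" using F by (simp add: noncritical_on_def)
  have "(F \<circ> p) holomorphic_on \<Omega>" using p holF by (intro holomorphic_on_compose_gen) auto
  moreover have "deriv (F \<circ> p) z \<noteq> 0" if z: "z \<in> \<Omega>" for z
  proof -
    have pz: "p z \<in> S" using p(3) z by blast
    have "deriv (F \<circ> p) z = deriv F (p z) * deriv p z"
      using p(1) holF assms(1,2) z pz
      by (intro deriv_chain) (auto intro: holomorphic_on_imp_differentiable_at)
    moreover have "deriv F (p z) \<noteq> 0" using F pz by (simp add: noncritical_on_def)
    moreover have "deriv p z \<noteq> 0" using holomorphic_injective_imp_regular[OF p(1) assms(1) p(2) z] .
    ultimately show ?thesis by simp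
  qed
  ultimately show ?thesis by (simp add: noncritical_on_def o_def)
qed

lemma restrict_in_locally_univalent:
  assumes "open \<Omega>" "noncritical_on \<Omega> f"
  shows "restrict f \<Omega> \<in> locally_univalent \<Omega>"
proof -
  have "restrict f \<Omega> holomorphic_on \<Omega>"
    using assms(2) by (auto simp: noncritical_on_def intro: holomorphic_transform)
  moreover have "deriv (restrict f \<Omega>) z = deriv f z" if z: "z \<in> \<Omega>" for z
  proof (rule deriv_cong_ev)
    show "\<forall>\<^sub>F w in nhds z. restrict f \<Omega> w = f w"
      using eventually_nhds_in_open[OF assms(1) z] by eventually_elim simp
  qed simp
  ultimately show ?thesis using assms(2) by (simp add: locally_univalent_def noncritical_on_def)
qed

text \<open>
  The inverse is the conjugate of the opposite translation, so it is holomorphic for the same reason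
  as the map itself.
\<close>
lemma conjugate_translation_conformal_automorphism:
  assumes p: "p holomorphic_on \<Omega>" and q: "q holomorphic_on S"
    and qp: "\<And>z. z \<in> \<Omega> \<Longrightarrow> p z \<in> S \<and> q (p z) = z" and pq: "\<And>w. w \<in> S \<Longrightarrow> q w \<in> \<Omega> \<and> p (q w) = w"
    and trans: "\<And>z t. z \<in> S \<Longrightarrow> z + of_real t \<in> S"
  shows "restrict (\<lambda>z. q (p z + of_real t)) \<Omega> \<in> conformal_automorphisms \<Omega>"
proof -
  define \<phi> where "\<phi> t = restrict (\<lambda>z. q (p z + of_real t)) \<Omega>" for t :: real
  have in_\<Omega>: "\<phi> t z \<in> \<Omega>" if "z \<in> \<Omega>" for t z using that qp pq trans by (simp add: \<phi>_def)
  have inverse: "\<phi> (- t) (\<phi> t z) = z" if "z \<in> \<Omega>" for t z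
  proof -
    have "p z + of_real t \<in> S" using that qp trans by blast
    then show ?thesis using that qp pq by (simp add: \<phi>_def)
  qed
  have bij: "bij_betw (\<phi> t) \<Omega> \<Omega>" for t
    by (rule bij_betw_byWitness[where f' = "\<phi> (- t)"])
      (use inverse[of _ t] inverse[of _ "- t"] in_\<Omega> in auto)
  have hol: "\<phi> t holomorphic_on \<Omega>" for t
  proof -
    have "(\<lambda>z. p z + of_real t) holomorphic_on \<Omega>" using p by (intro holomorphic_intros)
    then have "(q \<circ> (\<lambda>z. p z + of_real t)) holomorphic_on \<Omega>"
      using q qp trans by (intro holomorphic_on_compose_gen) auto
    then show ?thesis by (rule holomorphic_transform) (simp add: \<phi>_def)
  qed
  have "inv_into \<Omega> (\<phi> t) z = \<phi> (- t) z" if "z \<in> \<Omega>" for z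
    using bij_betw_imp_inj_on[OF bij] in_\<Omega>[OF that] inverse[OF that, of "- t"]
    by (intro inv_into_f_eq) auto
  then have "inv_into \<Omega> (\<phi> t) holomorphic_on \<Omega>"
    using holomorphic_transform[OF hol[of "- t"]] by metis
  then have "\<phi> t \<in> conformal_automorphisms \<Omega>"
    using bij hol by (simp add: conformal_automorphisms_def \<phi>_def)
  then show ?thesis by (simp add: \<phi>_def)
qed

theorem theorem1p3:
  fixes \<Omega> :: "complex set"
  assumes "open \<Omega>" and "connected \<Omega>" and "\<Omega> \<noteq> {}" and "simply_connected \<Omega>"
  shows "\<exists>f \<in> locally_univalent \<Omega>.
           lu_topology \<Omega> closure_of {compose \<Omega> f \<phi> | \<phi>. \<phi> \<in> conformal_automorphisms \<Omega>}
             = locally_univalent \<Omega>"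
proof -
  obtain S p q where S: "open S" "convex S" "0 \<in> S" and trans: "\<And>z t. z \<in> S \<Longrightarrow> z + of_real t \<in> S"
    and hol: "p holomorphic_on \<Omega>" "q holomorphic_on S"
    and qp: "\<And>z. z \<in> \<Omega> \<Longrightarrow> p z \<in> S \<and> q (p z) = z" and pq: "\<And>w. w \<in> S \<Longrightarrow> q w \<in> \<Omega> \<and> p (q w) = w"
    using simply_connected_biholomorphic_translation_invariant[OF assms(1,3,4)] by blast
  have inj: "inj_on p \<Omega>" "inj_on q S" using qp pq by (metis inj_onI)+
  obtain F where F: "noncritical_on S F"
    and univ: "\<And>f K e. noncritical_on S f \<Longrightarrow> compact K \<Longrightarrow> K \<subseteq> S \<Longrightarrow> e > 0 \<Longrightarrow>
       \<exists>t. \<forall>z\<in>K. dist (F (z + of_real t)) (f z) < e"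
    using universal_noncritical_translates[OF S trans] by blast
  define f where "f = restrict (\<lambda>z. F (p z)) \<Omega>"
  have f: "f \<in> locally_univalent \<Omega>"
    unfolding f_def
  proof (rule restrict_in_locally_univalent[OF assms(1)])
    show "noncritical_on \<Omega> (\<lambda>z. F (p z))"
      by (rule noncritical_on_compose[OF assms(1) S(1) hol(1) inj(1) _ F]) (use qp in blast)
  qed
  let ?O = "{compose \<Omega> f \<phi> | \<phi>. \<phi> \<in> conformal_automorphisms \<Omega>}"
  have "h \<in> lu_topology \<Omega> closure_of ?O" if h: "h \<in> locally_univalent \<Omega>" for h
    unfolding in_closure_of
  proof (intro conjI allI impI)
    show "h \<in> topspace (lu_topology \<Omega>)" using h by simp
    fix U assume U: "h \<in> U \<and> openin (lu_topology \<Omega>) U"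
    then obtain K e where K: "compact K" "K \<subseteq> \<Omega>" and e: "e > 0" and sub: "unif_nbhd \<Omega> K e h \<subseteq> U"
      unfolding openin_lu_topology by blast
    have h_nc: "noncritical_on \<Omega> h" using h by (simp add: locally_univalent_def noncritical_on_def)
    have "noncritical_on S (\<lambda>w. h (q w))"
      by (rule noncritical_on_compose[OF S(1) assms(1) hol(2) inj(2) _ h_nc]) (use pq in blast)
    moreover have "compact (p ` K)"
      using K hol(1) by (intro compact_continuous_image) (auto intro: holomorphic_on_imp_continuous_on continuous_on_subset)
    moreover have "p ` K \<subseteq> S" using K qp by blast
    ultimately obtain t where t: "\<forall>w\<in>p ` K. dist (F (w + of_real t)) (h (q w)) < e"
      using univ e by blast
    define \<phi> where "\<phi> = restrict (\<lambda>z. q (p z + of_real t)) \<Omega>"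
    have \<phi>: "\<phi> \<in> conformal_automorphisms \<Omega>"
      unfolding \<phi>_def using hol qp pq trans by (rule conjugate_translation_conformal_automorphism)
    have "dist (compose \<Omega> f \<phi> z) (h z) < e" if z: "z \<in> K" for z
    proof -
      have z\<Omega>: "z \<in> \<Omega>" using z K by blast
      then have "p z + of_real t \<in> S" using qp trans by blast
      then have "compose \<Omega> f \<phi> z = F (p z + of_real t)"
        using z\<Omega> pq by (simp add: compose_def f_def \<phi>_def)
      moreover have "h (q (p z)) = h z" using qp z\<Omega> by simp
      moreover have "dist (F (p z + of_real t)) (h (q (p z))) < e" using t z by blast
      ultimately show ?thesis by simp
    qed
    then have "compose \<Omega> f \<phi> \<in> unif_nbhd \<Omega> K e h"
      using compose_in_locally_univalent[OF assms(1) f \<phi>] by (simp add: unif_nbhd_def)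
    then show "\<exists>y. y \<in> ?O \<and> y \<in> U" using sub \<phi> by blast
  qed
  moreover have "lu_topology \<Omega> closure_of ?O \<subseteq> locally_univalent \<Omega>"
    using closure_of_subset_topspace[of "lu_topology \<Omega>" ?O] by simp
  ultimately show ?thesis using f by blast
qed

end
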